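(* Let $n,k$ be integers with $k\ge 0$ and $n\ge 3k-1$, $n\ge k$. Let $B=\sum_{\ell=0}^{k}b_\ell\,\mathcal{A}_{n,k,\ell}$, where the $b_\ell$ are integers. For $0\le s\le k$ define the $(k-s+1)\times(k-s+1)$ matrix $\mathcal{M}_s(B)$, with rows and columns indexed by $s\le i,j\le k$, whose $(i,j)$-entry is $$\binom{j-s}{i-s}\sum_{\ell=0}^{k}b_\ell\,f_i(j;n,k,\ell).$$ Then $$S(B)\cong\bigoplus_{s=0}^{k}S(\mathcal{M}_s(B))^{\binom{n}{s}-2\binom{n}{s-1}+\binom{n}{s-2}}.$$
   Context: Binomial convention: $\binom{a}{b}=0$ whenever $b<0$ or $a<b$. $\mathcal{A}_{n,k,\ell}$ is the matrix with rows and columns indexed by the $k$-element subsets of $\{1,\dots,n\}$, with $(A,B)$ entry $1$ if $|A\cap B|=\ell$ and $0$ otherwise (an association matrix of the Johnson scheme). Define $$f_i(j;n,k,\ell)=\sum_{v=0}^{i}(-1)^{i+v}\binom{i}{v}\binom{k-v}{\ell-v}\binom{n-k-j+v}{k-\ell-j+v}.$$ The Smith group of an $m\times n$ integer matrix $M$ is $S(M)=\mathbb{Z}^n/\mathrm{row}_{\mathbb{Z}}(M)$, where $\mathrm{row}_{\mathbb{Z}}(M)$ is the set of integer linear combinations of the rows of $M$. For an abelian group $G$, $G^m$ is the direct sum of $m$ copies of $G$. *)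

theory Defs
  imports "HOL-Algebra.Product_Groups" "HOL-Library.Ramsey"
begin

text \<open>Binomial coefficients of integers: zero if \<open>b < 0\<close> or \<open>a < b\<close>, hence in particular whenever
  \<open>a < 0\<close>. This differs from \<open>gchoose\<close>, which need not vanish for negative \<open>a\<close>.\<close>

definition zbinom :: "int \<Rightarrow> int \<Rightarrow> int" where
  "zbinom a b = (if b < 0 \<or> a < b then 0 else int (nat a choose nat b))"

definition assoc_matrix :: "nat \<Rightarrow> nat set \<Rightarrow> nat set \<Rightarrow> int" where
  "assoc_matrix l A B = (if card (A \<inter> B) = l then 1 else 0)"

definition johnson_f :: "nat \<Rightarrow> nat \<Rightarrow> nat \<Rightarrow> nat \<Rightarrow> nat \<Rightarrow> int" where
  "johnson_f i j n k l =
     (\<Sum>v = 0..i. (-1) ^ (i + v) * zbinom (int i) (int v) * zbinom (int k - int v) (int l - int v)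
        * zbinom (int n - int k - int j + int v) (int k - int l - int j + int v))"

text \<open>A matrix is a function of a row and a column index, accompanied by its sets of row and
  column indices; values of the function outside these sets are irrelevant.\<close>

definition row_lattice :: "'r set \<Rightarrow> 'c set \<Rightarrow> ('r \<Rightarrow> 'c \<Rightarrow> int) \<Rightarrow> ('c \<Rightarrow> int) set" where
  "row_lattice R C M = {(\<lambda>j\<in>C. \<Sum>i\<in>R. a i * M i j) | a. True}"

definition smith_group ::
    "'r set \<Rightarrow> 'c set \<Rightarrow> ('r \<Rightarrow> 'c \<Rightarrow> int) \<Rightarrow> ('c \<Rightarrow> int) set monoid" where
  "smith_group R C M = product_group C (\<lambda>_. integer_group) Mod row_lattice R C M"

lemma row_lattice_normal: "row_lattice R C M \<lhd> product_group C (\<lambda>_. integer_group)"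
proof -
  let ?G = "product_group C (\<lambda>_. integer_group)"
  interpret G: group ?G
    by (simp add: product_group)
  interpret G: comm_group ?G
    by (rule G.group_comm_groupI) (auto simp: fun_eq_iff add.commute)
  have "subgroup (row_lattice R C M) ?G"
  proof (rule G.subgroupI)
    show "row_lattice R C M \<subseteq> carrier ?G"
      by (auto simp: row_lattice_def)
    show "row_lattice R C M \<noteq> {}"
      by (auto simp: row_lattice_def)
  next
    fix x assume "x \<in> row_lattice R C M"
    then obtain a where x: "x = (\<lambda>j\<in>C. \<Sum>i\<in>R. a i * M i j)"
      by (auto simp: row_lattice_def)
    have "inv\<^bsub>?G\<^esub> x = (\<lambda>j\<in>C. - x j)"
      by (subst inv_product_group) (auto simp: x)
    also have "\<dots> = (\<lambda>j\<in>C. \<Sum>i\<in>R. (- a i) * M i j)"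
      by (auto simp: x sum_negf restrict_def fun_eq_iff)
    finally show "inv\<^bsub>?G\<^esub> x \<in> row_lattice R C M"
      unfolding row_lattice_def by (intro CollectI exI[of _ "\<lambda>i. - a i"]) simp
  next
    fix x y assume "x \<in> row_lattice R C M" "y \<in> row_lattice R C M"
    then obtain a b where x: "x = (\<lambda>j\<in>C. \<Sum>i\<in>R. a i * M i j)"
      and y: "y = (\<lambda>j\<in>C. \<Sum>i\<in>R. b i * M i j)"
      by (auto simp: row_lattice_def)
    have "x \<otimes>\<^bsub>?G\<^esub> y = (\<lambda>j\<in>C. \<Sum>i\<in>R. (a i + b i) * M i j)"
      by (auto simp: x y fun_eq_iff sum.distrib distrib_right)
    then show "x \<otimes>\<^bsub>?G\<^esub> y \<in> row_lattice R C M"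
      unfolding row_lattice_def by (intro CollectI exI[of _ "\<lambda>i. a i + b i"]) simp
  qed
  then show ?thesis
    by (rule G.subgroup_imp_normal)
qed

lemma group_smith_group: "group (smith_group R C M)"
  unfolding smith_group_def by (rule normal.factorgroup_is_group[OF row_lattice_normal])

definition group_power :: "('a, 'b) monoid_scheme \<Rightarrow> nat \<Rightarrow> (nat \<Rightarrow> 'a) monoid" where
  "group_power G m = sum_group {..<m} (\<lambda>_. G)"

definition johnson_M :: "nat \<Rightarrow> nat \<Rightarrow> (nat \<Rightarrow> int) \<Rightarrow> nat \<Rightarrow> nat \<Rightarrow> nat \<Rightarrow> int" where
  "johnson_M n k b s i j =
     zbinom (int j - int s) (int i - int s) * (\<Sum>l = 0..k. b l * johnson_f i j n k l)"

definition johnson_mult :: "nat \<Rightarrow> nat \<Rightarrow> int" where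
  "johnson_mult n s =
     zbinom (int n) (int s) - 2 * zbinom (int n) (int s - 1) + zbinom (int n) (int s - 2)"

text \<open>The multiplicities are nonnegative in the relevant range, so that \<open>nat\<close> does not truncate.\<close>

lemma johnson_mult_nonneg:
  assumes "s \<le> k" "int n \<ge> 3 * int k - 1" "n \<ge> k"
  shows "johnson_mult n s \<ge> 0"
proof -
  consider "s = 0" | "s = 1" | t where "s = Suc (Suc t)"
    by (metis One_nat_def not0_implies_Suc)
  then show ?thesis
  proof cases
    case 1
    then show ?thesis by (simp add: johnson_mult_def zbinom_def)
  next
    case 2
    then show ?thesis using assms by (simp add: johnson_mult_def zbinom_def)
  next
    case 3
    define m where "m = int n - int s"
    define a b c where "a = int (n choose t)" and "b = int (n choose Suc t)"
      and "c = int (n choose Suc (Suc t))"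
    have n: "n \<ge> s" and m: "m \<ge> 2 * int s - 1" using assms by (auto simp: m_def)
    have rec: "(int r + 1) * int (n choose Suc r) = (int n - int r) * int (n choose r)"
      if "r \<le> n" for r
    proof -
      have "Suc r * (n choose Suc r) = (n - r) * (n choose r)"
        by (metis binomial_absorb_comp binomial_absorption mult.commute)
      then have "int (Suc r * (n choose Suc r)) = int ((n - r) * (n choose r))" by simp
      then show ?thesis using that by (simp add: of_nat_diff algebra_simps)
    qed
    have b: "(int s - 1) * b = (m + 2) * a"
      using rec[of t] n 3 by (simp add: m_def a_def b_def algebra_simps)
    have c: "int s * c = (m + 1) * b"
      using rec[of "Suc t"] n 3 by (simp add: m_def b_def c_def algebra_simps)
    have "int s * (int s - 1) * (c - 2 * b + a)
        = (int s - 1) * (int s * c) - 2 * int s * ((int s - 1) * b) + int s * (int s - 1) * a"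
      by (simp add: algebra_simps)
    also have "\<dots> = (m + 1) * ((int s - 1) * b) - 2 * int s * ((int s - 1) * b)
        + int s * (int s - 1) * a"
      unfolding c by (simp add: algebra_simps)
    also have "\<dots> = a * ((m - int s)\<^sup>2 + 3 * m - 5 * int s + 2)"
      unfolding b by (simp add: algebra_simps power2_eq_square)
    finally have eq: "int s * (int s - 1) * (c - 2 * b + a)
        = a * ((m - int s)\<^sup>2 + 3 * m - 5 * int s + 2)" .
    have "3 * m - 5 * int s + 2 \<ge> 0" using m 3 by simp
    then have "(m - int s)\<^sup>2 + 3 * m - 5 * int s + 2 \<ge> 0"
      using zero_le_power2[of "m - int s"] by linarith
    then have "int s * (int s - 1) * (c - 2 * b + a) \<ge> 0"
      unfolding eq by (simp add: a_def)
    moreover have "int s * (int s - 1) > 0" using 3 by simp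
    ultimately have "c - 2 * b + a \<ge> 0"
      by (simp add: zero_le_mult_iff)
    moreover have "johnson_mult n s = c - 2 * b + a"
      using n 3 by (simp add: johnson_mult_def zbinom_def a_def b_def c_def nat_add_distrib)
    ultimately show ?thesis by simp
  qed
qed

end

theory Submission
  imports Defs
begin

text \<open>Let \<open>N\<close> be the set of \<open>k\<close>-subsets of \<open>{1..n}\<close>. For a function \<open>\<phi>\<close> on \<open>N\<close> and a
  set \<open>T\<close> let \<open>\<Psi> \<phi> T\<close> be the sum of \<open>\<phi>\<close> over the members of \<open>N\<close> that contain \<open>T\<close>. How many
  \<open>k\<close>-sets contain \<open>T\<close> and meet a given \<open>k\<close>-set \<open>K\<close> in \<open>l\<close> points depends only on
  \<open>card T\<close> and \<open>card (T \<inter> K)\<close>. Moebius inversion over the subsets of \<open>T \<inter> K\<close> turns this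
  count into a sum over them, with the coefficients \<open>johnson_f\<close>. Hence, with
  \<open>c i j = (\<Sum>l. b l * johnson_f i j n k l)\<close>,
  \<open>\<Psi> (\<phi> B) T = (\<Sum>U\<in>Pow T. c (card U) (card T) * \<Psi> \<phi> U)\<close>
  (\<open>superset_sum_johnson\<close>).

  The sum over \<open>U\<close> stays inside every family of sets that is closed under subsets. Such a
  family is the complex \<open>\<Delta>\<close> of ballot sets, the sets whose \<open>i\<close>-th smallest element is at least
  \<open>2 i\<close> (standard Young tableaux with two rows), of size at most \<open>k\<close>. By a classical theorem,
  \<open>ballot_basis\<close>, the inclusion matrix of \<open>\<Delta>\<close> against \<open>N\<close> is invertible over the integers, so
  \<open>\<Psi>\<close> is an isomorphism from the functions on \<open>N\<close> to the functions on \<open>\<Delta>\<close>. The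
  Smith group of \<open>B\<close> is therefore the cokernel of the operator
  \<open>u \<mapsto> (\<lambda>F. \<Sum>U\<in>Pow F. c (card U) (card F) * u U)\<close> on functions on \<open>\<Delta>\<close>.

  This operator only depends on inclusions in \<open>\<Delta>\<close> and on cardinalities, and it respects
  chains: for a set \<open>T\<close> of size \<open>s\<close> let \<open>w T j\<close> be the indicator function of the members of
  \<open>\<Delta>\<close> of size \<open>j\<close> that contain \<open>T\<close>. Counting the sets of size \<open>i\<close> between \<open>T\<close> and a set of
  size \<open>j\<close>, the operator maps \<open>w T i\<close> to the sum over \<open>j\<close> of
  \<open>(j - s choose i - s) * c i j\<close> times \<open>w T j\<close>, which is row \<open>i\<close> of \<open>johnson_M n k b s\<close>
  (\<open>sum_chain_transfer\<close>). So the theorem follows once there is a family \<open>S\<close> of sets such that,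
  for each \<open>j \<le> k\<close>, the \<open>w T j\<close> with \<open>T \<in> S\<close> and \<open>card T \<le> j\<close> form an integral basis of
  the functions on the members of \<open>\<Delta>\<close> of size \<open>j\<close>. The multiplicities are then forced: the number
  of members of size \<open>j\<close> in \<open>\<Delta>\<close> is a first difference of binomial coefficients, and the number
  of members of size \<open>s\<close> in \<open>S\<close> is the difference of two such numbers (\<open>card_chain_starts\<close>).

  The family \<open>S\<close> is where \<open>3 k \<le> n + 1\<close> is needed (\<open>shifted_complex_basis\<close>). All
  subsets of size at most \<open>k\<close> of \<open>{k + 1..n}\<close> are ballot sets, and as this interval has at least
  \<open>2 k - 1\<close> elements, \<open>ballot_basis\<close> applied to it yields \<open>S\<close> for the
  complex of these subsets. Adding the points \<open>k, k - 1, \<dots>, 2\<close> one at a time, the inclusion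
  matrices become block triangular with respect to the sets avoiding and containing the new point,
  and the family for the larger complex is assembled from families for the deletion and the link of
  that point.\<close>


section \<open>Integral bases given by inclusion matrices\<close>

definition subset_sum :: "'a set set \<Rightarrow> ('a set \<Rightarrow> int) \<Rightarrow> 'a set \<Rightarrow> int" where
  "subset_sum S a F = (\<Sum>T\<in>{T \<in> S. T \<subseteq> F}. a T)"

text \<open>The 0-1 matrix of the inclusions of members of \<open>S\<close> in members of \<open>\<F>\<close> is
  invertible over the integers. Unique solvability is the form in which triangular systems are
  easiest to solve; an inverse matrix is extracted in \<open>inclusion_basis_inverse\<close>.\<close>

definition inclusion_basis :: "'a set set \<Rightarrow> 'a set set \<Rightarrow> bool" where
  "inclusion_basis S \<F> \<longleftrightarrow>
     (\<forall>g. \<exists>a. \<forall>F\<in>\<F>. subset_sum S a F = g F) \<and>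
     (\<forall>a. (\<forall>F\<in>\<F>. subset_sum S a F = 0) \<longrightarrow> (\<forall>T\<in>S. a T = 0))"

lemma inclusion_basis_solve:
  assumes "inclusion_basis S \<F>"
  obtains a where "\<And>F. F \<in> \<F> \<Longrightarrow> subset_sum S a F = g F"
  using assms unfolding inclusion_basis_def by meson

lemma inclusion_basis_zero:
  assumes "inclusion_basis S \<F>" "\<And>F. F \<in> \<F> \<Longrightarrow> subset_sum S a F = 0" "T \<in> S"
  shows "a T = 0"
  using assms unfolding inclusion_basis_def by meson

lemma subset_sum_cong:
  "(\<And>T. T \<in> S \<Longrightarrow> a T = a' T) \<Longrightarrow> subset_sum S a F = subset_sum S a' F"
  unfolding subset_sum_def by (rule sum.cong) auto

lemma subset_sum_diff:
  "subset_sum S (\<lambda>T. a T - a' T) F = subset_sum S a F - subset_sum S a' F"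
  unfolding subset_sum_def by (rule sum_subtractf)

lemma subset_sum_add:
  "subset_sum S (\<lambda>T. a T + a' T) F = subset_sum S a F + subset_sum S a' F"
  unfolding subset_sum_def by (rule sum.distrib)

lemma subset_sum_zero: "subset_sum S (\<lambda>T. 0) F = 0"
  by (simp add: subset_sum_def)

lemma subset_sum_level:
  assumes "finite F"
  shows "subset_sum {T \<in> S. card T \<le> card F} a F = subset_sum S a F"
proof -
  have "{T \<in> {T \<in> S. card T \<le> card F}. T \<subseteq> F} = {T \<in> S. T \<subseteq> F}"
    using card_mono[OF assms] by blast
  then show ?thesis by (simp only: subset_sum_def)
qed

lemma inclusion_basis_inj:
  assumes "inclusion_basis S \<F>" "\<And>F. F \<in> \<F> \<Longrightarrow> subset_sum S a F = subset_sum S a' F" "T \<in> S"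
  shows "a T = a' T"
  using inclusion_basis_zero[of S \<F> "\<lambda>T. a T - a' T" T] assms
  by (simp add: subset_sum_diff)

lemma inclusion_basis_empty: "inclusion_basis {} {}"
  by (simp add: inclusion_basis_def)

lemma inclusion_basis_point: "inclusion_basis {{}} {F}"
proof -
  have "{T. T = {} \<and> T \<subseteq> F} = {{}}" by auto
  then have *: "subset_sum {{}} a F = a {}" for a
    by (simp add: subset_sum_def)
  show ?thesis unfolding inclusion_basis_def * by (auto simp: *)
qed

lemma subset_sum_subdivide:
  assumes "finite S" "P \<subseteq> S"
  shows "subset_sum S a F = subset_sum P a F + subset_sum (S - P) a F"
proof -
  have "{T \<in> S. T \<subseteq> F} = {T \<in> P. T \<subseteq> F} \<union> {T \<in> S - P. T \<subseteq> F}" using assms by auto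
  then show ?thesis unfolding subset_sum_def
    using assms finite_subset[OF assms(2,1)] by (subst sum.union_disjoint[symmetric]) auto
qed

context
  fixes S0 S1 \<F>0 \<F>1 :: "'a set set" and v :: 'a
  assumes fin: "finite S0" "finite S1"
    and v: "v \<notin> \<Union>S0" "v \<notin> \<Union>S1" "v \<notin> \<Union>\<F>0" "v \<notin> \<Union>\<F>1"
begin

lemma subset_sum_deletion:
  assumes "v \<notin> F"
  shows "subset_sum (S0 \<union> insert v ` S1) a F = subset_sum S0 a F"
proof -
  have "{T \<in> S0 \<union> insert v ` S1. T \<subseteq> F} = {T \<in> S0. T \<subseteq> F}" using assms by auto
  then show ?thesis by (simp add: subset_sum_def)
qed

lemma subset_sum_link:
  assumes "v \<notin> F"
  shows "subset_sum (S0 \<union> insert v ` S1) a (insert v F)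
    = subset_sum S0 a F + subset_sum S1 (\<lambda>T. a (insert v T)) F"
proof -
  have eq: "{T \<in> S0 \<union> insert v ` S1. T \<subseteq> insert v F}
      = {T \<in> S0. T \<subseteq> F} \<union> insert v ` {T \<in> S1. T \<subseteq> F}"
  proof -
    have "T \<subseteq> insert v F \<longleftrightarrow> T \<subseteq> F" if "T \<in> S0" for T using v that by blast
    moreover have "insert v T \<subseteq> insert v F \<longleftrightarrow> T \<subseteq> F" if "T \<in> S1" for T using v that by blast
    ultimately show ?thesis by auto
  qed
  have "inj_on (insert v) {T \<in> S1. T \<subseteq> F}"
  proof (rule inj_onI)
    fix X Y assume "X \<in> {T \<in> S1. T \<subseteq> F}" "Y \<in> {T \<in> S1. T \<subseteq> F}" "insert v X = insert v Y"
    moreover from this have "v \<notin> X" "v \<notin> Y" using v by blast+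
    ultimately show "X = Y" by (simp add: insert_ident)
  qed
  then have link: "(\<Sum>T\<in>insert v ` {T \<in> S1. T \<subseteq> F}. a T)
      = subset_sum S1 (\<lambda>T. a (insert v T)) F"
    by (simp add: sum.reindex subset_sum_def)
  have "subset_sum (S0 \<union> insert v ` S1) a (insert v F)
      = (\<Sum>T\<in>{T \<in> S0. T \<subseteq> F} \<union> insert v ` {T \<in> S1. T \<subseteq> F}. a T)"
    by (simp only: subset_sum_def eq)
  also have "\<dots> = subset_sum S0 a F + subset_sum S1 (\<lambda>T. a (insert v T)) F"
    unfolding link[symmetric] subset_sum_def[of S0]
  proof (rule sum.union_disjoint)
    show "{T \<in> S0. T \<subseteq> F} \<inter> insert v ` {T \<in> S1. T \<subseteq> F} = {}" using v by blast
  qed (use fin in auto)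
  finally show ?thesis .
qed

text \<open>The inclusion matrix is block triangular with respect to the sets avoiding and containing
  \<open>v\<close>, as a set containing \<open>v\<close> is never included in one that avoids it. The coefficients \<open>a\<close>
  belong to the members of \<open>S0\<close>, the coefficients \<open>c\<close> to the sets \<open>insert v T\<close>.\<close>

lemma inclusion_basis_split:
  assumes surj: "\<And>g. \<exists>a c. (\<forall>F\<in>\<F>0. subset_sum S0 a F = g F) \<and>
      (\<forall>F\<in>\<F>1. subset_sum S0 a F + subset_sum S1 c F = g (insert v F))"
    and inj: "\<And>a c. \<forall>F\<in>\<F>0. subset_sum S0 a F = 0 \<Longrightarrow>
      \<forall>F\<in>\<F>1. subset_sum S0 a F + subset_sum S1 c F = 0 \<Longrightarrow>
      (\<forall>T\<in>S0. a T = 0) \<and> (\<forall>T\<in>S1. c T = 0)"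
  shows "inclusion_basis (S0 \<union> insert v ` S1) (\<F>0 \<union> insert v ` \<F>1)"
proof -
  let ?S = "S0 \<union> insert v ` S1"
  have del: "subset_sum ?S a F = subset_sum S0 a F" if "F \<in> \<F>0" for a F
    using that v by (intro subset_sum_deletion) auto
  have lnk: "subset_sum ?S a (insert v F)
    = subset_sum S0 a F + subset_sum S1 (\<lambda>T. a (insert v T)) F" if "F \<in> \<F>1" for a F
    using that v by (intro subset_sum_link) auto
  show ?thesis unfolding inclusion_basis_def
  proof (intro conjI allI impI)
    fix g :: "'a set \<Rightarrow> int"
    obtain a c where a: "\<And>F. F \<in> \<F>0 \<Longrightarrow> subset_sum S0 a F = g F"
      and c: "\<And>F. F \<in> \<F>1 \<Longrightarrow> subset_sum S0 a F + subset_sum S1 c F = g (insert v F)"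
      using surj[of g] by blast
    define e where "e T = (if v \<in> T then c (T - {v}) else a T)" for T
    have "subset_sum S0 e F = subset_sum S0 a F" for F
      using v by (intro subset_sum_cong) (auto simp: e_def)
    moreover have "subset_sum S1 (\<lambda>T. e (insert v T)) F = subset_sum S1 c F" for F
      using v by (intro subset_sum_cong) (auto simp: e_def)
    ultimately have "\<forall>F\<in>\<F>0 \<union> insert v ` \<F>1. subset_sum ?S e F = g F"
      using a c by (auto simp: del lnk)
    then show "\<exists>a. \<forall>F\<in>\<F>0 \<union> insert v ` \<F>1. subset_sum ?S a F = g F"
      by (rule exI[where x = e])
  next
    fix a assume 0: "\<forall>F\<in>\<F>0 \<union> insert v ` \<F>1. subset_sum ?S a F = 0"
    have "(\<forall>T\<in>S0. a T = 0) \<and> (\<forall>T\<in>S1. a (insert v T) = 0)"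
      using 0 by (intro inj[of a "\<lambda>T. a (insert v T)"]) (simp_all add: del lnk ball_Un)
    then show "\<forall>T\<in>?S. a T = 0" by auto
  qed
qed

text \<open>The diagonal blocks are the two given inclusion matrices: the first system determines \<open>a\<close>,
  after which the second determines \<open>c\<close>.\<close>

lemma inclusion_basis_cone:
  assumes 0: "inclusion_basis S0 \<F>0" and 1: "inclusion_basis S1 \<F>1"
  shows "inclusion_basis (S0 \<union> insert v ` S1) (\<F>0 \<union> insert v ` \<F>1)"
proof (rule inclusion_basis_split)
  fix g :: "'a set \<Rightarrow> int"
  obtain a where a: "\<And>F. F \<in> \<F>0 \<Longrightarrow> subset_sum S0 a F = g F"
    using inclusion_basis_solve[OF 0] by metis
  obtain c where "\<And>F. F \<in> \<F>1 \<Longrightarrow> subset_sum S1 c F = g (insert v F) - subset_sum S0 a F"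
    using inclusion_basis_solve[OF 1, of "\<lambda>F. g (insert v F) - subset_sum S0 a F"] by metis
  with a show "\<exists>a c. (\<forall>F\<in>\<F>0. subset_sum S0 a F = g F) \<and>
      (\<forall>F\<in>\<F>1. subset_sum S0 a F + subset_sum S1 c F = g (insert v F))"
    by (intro exI[of _ a] exI[of _ c]) simp
next
  fix a c
  assume z: "\<forall>F\<in>\<F>0. subset_sum S0 a F = 0"
    "\<forall>F\<in>\<F>1. subset_sum S0 a F + subset_sum S1 c F = 0"
  have a: "a T = 0" if "T \<in> S0" for T
    using inclusion_basis_zero[OF 0 _ that, of a] z by simp
  have "subset_sum S0 a F = 0" for F
    using subset_sum_cong[of S0 a "\<lambda>_. 0" F] a by (simp add: subset_sum_zero)
  then have "c T = 0" if "T \<in> S1" for T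
    using inclusion_basis_zero[OF 1 _ that, of c] z by simp
  with a show "(\<forall>T\<in>S0. a T = 0) \<and> (\<forall>T\<in>S1. c T = 0)" by simp
qed

text \<open>Here the blocks are not square, and the order of elimination is reversed. On the sets
  containing \<open>v\<close> only the sum \<open>a + c\<close> occurs, where \<open>c\<close> is extended by zero to \<open>S0\<close>, and the
  second system determines it. This gives \<open>a\<close> outside \<open>S1\<close>, the first system gives \<open>a\<close> on
  \<open>S1\<close>, and \<open>c\<close> is what remains.\<close>

lemma inclusion_basis_cone_swap:
  assumes sub: "S1 \<subseteq> S0"
    and 0: "inclusion_basis S1 \<F>0" and 1: "inclusion_basis S0 \<F>1"
  shows "inclusion_basis (S0 \<union> insert v ` S1) (\<F>0 \<union> insert v ` \<F>1)"
proof (rule inclusion_basis_split)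
  fix g :: "'a set \<Rightarrow> int"
  obtain c where c: "\<And>F. F \<in> \<F>1 \<Longrightarrow> subset_sum S0 c F = g (insert v F)"
    using inclusion_basis_solve[OF 1, of "\<lambda>F. g (insert v F)"] by metis
  obtain e where e: "\<And>F. F \<in> \<F>0 \<Longrightarrow> subset_sum S1 e F = g F - subset_sum (S0 - S1) c F"
    using inclusion_basis_solve[OF 0, of "\<lambda>F. g F - subset_sum (S0 - S1) c F"] by metis
  define a where "a T = (if T \<in> S1 then e T else c T)" for T
  have a: "subset_sum S0 a F = subset_sum S1 e F + subset_sum (S0 - S1) c F" for F
    unfolding subset_sum_subdivide[OF fin(1) sub, of a F]
    by (intro arg_cong2[where f = "(+)"] subset_sum_cong) (auto simp: a_def)
  then have "\<forall>F\<in>\<F>1. subset_sum S0 a F + subset_sum S1 (\<lambda>T. c T - e T) F = g (insert v F)"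
    using c subset_sum_subdivide[OF fin(1) sub, of c] by (simp add: subset_sum_diff add.commute)
  moreover have "\<forall>F\<in>\<F>0. subset_sum S0 a F = g F" using a e by simp
  ultimately show "\<exists>a c. (\<forall>F\<in>\<F>0. subset_sum S0 a F = g F) \<and>
      (\<forall>F\<in>\<F>1. subset_sum S0 a F + subset_sum S1 c F = g (insert v F))"
    by blast
next
  fix a c
  assume z: "\<forall>F\<in>\<F>0. subset_sum S0 a F = 0"
    "\<forall>F\<in>\<F>1. subset_sum S0 a F + subset_sum S1 c F = 0"
  define e where "e T = a T + (if T \<in> S1 then c T else 0)" for T
  have "subset_sum S0 (\<lambda>T. if T \<in> S1 then c T else 0) F = subset_sum S1 c F" for F
  proof -
    have "subset_sum S1 (\<lambda>T. if T \<in> S1 then c T else 0) F = subset_sum S1 c F"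
      by (rule subset_sum_cong) simp
    moreover have "subset_sum (S0 - S1) (\<lambda>T. if T \<in> S1 then c T else 0) F
        = subset_sum (S0 - S1) (\<lambda>T. 0) F"
      by (rule subset_sum_cong) simp
    ultimately show ?thesis
      by (simp add: subset_sum_subdivide[OF fin(1) sub] subset_sum_zero)
  qed
  then have "subset_sum S0 e F = subset_sum S0 a F + subset_sum S1 c F" for F
    unfolding e_def by (simp add: subset_sum_add)
  then have e: "e T = 0" if "T \<in> S0" for T
    using inclusion_basis_zero[OF 1 _ that, of e] z by simp
  have "a T = 0" if "T \<in> S0 - S1" for T
    using e[of T] that by (simp add: e_def)
  then have "subset_sum (S0 - S1) a F = 0" for F
    using subset_sum_cong[of "S0 - S1" a "\<lambda>_. 0" F] by (simp add: subset_sum_zero)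
  then have a: "a T = 0" if "T \<in> S1" for T
    using inclusion_basis_zero[OF 0 _ that, of a] z
    by (simp add: subset_sum_subdivide[OF fin(1) sub])
  show "(\<forall>T\<in>S0. a T = 0) \<and> (\<forall>T\<in>S1. c T = 0)"
  proof (intro conjI ballI)
    show "a T = 0" if "T \<in> S0" for T
      using a e[OF that] by (cases "T \<in> S1") (auto simp: e_def)
    show "c T = 0" if "T \<in> S1" for T
      using a[OF that] e[of T] sub that by (auto simp: e_def)
  qed
qed

end

text \<open>The rows of the inverse solve the systems whose right-hand sides are unit vectors, which
  makes it a one-sided inverse; by uniqueness of solutions it is two-sided.\<close>

lemma inclusion_basis_inverse:
  assumes fin: "finite S" "finite \<F>" and basis: "inclusion_basis S \<F>"
  obtains Y where
    "\<And>F F'. F \<in> \<F> \<Longrightarrow> F' \<in> \<F> \<Longrightarrow> (\<Sum>T\<in>S. Y F T * of_bool (T \<subseteq> F')) = (of_bool (F = F') :: int)"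
    "\<And>T T'. T \<in> S \<Longrightarrow> T' \<in> S \<Longrightarrow> (\<Sum>F\<in>\<F>. of_bool (T \<subseteq> F) * Y F T') = (of_bool (T = T') :: int)"
proof -
  have ss: "subset_sum S a F = (\<Sum>T\<in>S. a T * of_bool (T \<subseteq> F))" for a F
    unfolding subset_sum_def using fin by (intro sum.mono_neutral_cong_left) auto
  have "\<forall>F. \<exists>a. \<forall>F'\<in>\<F>. subset_sum S a F' = of_bool (F = F')"
  proof
    fix F
    have "\<forall>g. \<exists>a. \<forall>F\<in>\<F>. subset_sum S a F = g F"
      using basis by (simp add: inclusion_basis_def)
    from spec[OF this, of "\<lambda>F'. of_bool (F = F')"]
    show "\<exists>a. \<forall>F'\<in>\<F>. subset_sum S a F' = of_bool (F = F')" .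
  qed
  from choice[OF this]
  obtain Y where Y: "\<And>F F'. F' \<in> \<F> \<Longrightarrow> subset_sum S (Y F) F' = of_bool (F = F')"
    by blast
  have "(\<Sum>F\<in>\<F>. of_bool (T \<subseteq> F) * Y F T') = of_bool (T = T')" if T: "T \<in> S" "T' \<in> S" for T T'
  proof (rule inclusion_basis_inj[OF basis _ T(2)])
    fix F' assume F': "F' \<in> \<F>"
    have "subset_sum S (\<lambda>T'. \<Sum>F\<in>\<F>. of_bool (T \<subseteq> F) * Y F T') F'
        = (\<Sum>F\<in>\<F>. of_bool (T \<subseteq> F) * subset_sum S (Y F) F')"
      unfolding ss sum_distrib_right sum_distrib_left
      by (subst sum.swap) (simp add: mult.assoc)
    also have "\<dots> = of_bool (T \<subseteq> F')"
      using F' fin by (simp add: Y)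
    also have "\<dots> = subset_sum S (\<lambda>T'. of_bool (T = T')) F'"
      using T fin by (simp add: ss)
    finally show "subset_sum S (\<lambda>T'. \<Sum>F\<in>\<F>. of_bool (T \<subseteq> F) * Y F T') F'
      = subset_sum S (\<lambda>T'. of_bool (T = T')) F'" .
  qed
  with Y show ?thesis by (intro that[of Y]) (auto simp: ss)
qed

text \<open>Both numbers are the trace of the product of the inclusion matrix and its inverse, taken in
  either order.\<close>

lemma inclusion_basis_card:
  assumes "finite S" "finite \<F>" "inclusion_basis S \<F>"
  shows "card S = card \<F>"
proof -
  obtain Y where Y:
    "\<And>F F'. F \<in> \<F> \<Longrightarrow> F' \<in> \<F> \<Longrightarrow> (\<Sum>T\<in>S. Y F T * of_bool (T \<subseteq> F')) = (of_bool (F = F') :: int)"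
    "\<And>T T'. T \<in> S \<Longrightarrow> T' \<in> S \<Longrightarrow> (\<Sum>F\<in>\<F>. of_bool (T \<subseteq> F) * Y F T') = (of_bool (T = T') :: int)"
    by (rule inclusion_basis_inverse[OF assms]) blast
  have "int (card S) = (\<Sum>T\<in>S. \<Sum>F\<in>\<F>. of_bool (T \<subseteq> F) * Y F T)"
    using Y(2) by simp
  also have "\<dots> = (\<Sum>F\<in>\<F>. \<Sum>T\<in>S. Y F T * of_bool (T \<subseteq> F))"
    by (subst sum.swap) (simp add: mult.commute)
  also have "\<dots> = int (card \<F>)" using Y(1) by simp
  finally show ?thesis by simp
qed

definition superset_sum :: "'a set set \<Rightarrow> ('a set \<Rightarrow> int) \<Rightarrow> 'a set \<Rightarrow> int" where
  "superset_sum \<F> \<phi> T = (\<Sum>F\<in>{F \<in> \<F>. T \<subseteq> F}. \<phi> F)"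

lemma superset_sum_cong:
  "(\<And>F. F \<in> \<F> \<Longrightarrow> \<phi> F = \<psi> F) \<Longrightarrow> superset_sum \<F> \<phi> T = superset_sum \<F> \<psi> T"
  unfolding superset_sum_def by (rule sum.cong) auto

text \<open>The transpose of an invertible matrix is invertible.\<close>

lemma inclusion_basis_dual:
  assumes fin: "finite S" "finite \<F>" and basis: "inclusion_basis S \<F>"
  shows "\<exists>\<phi>. \<forall>T\<in>S. superset_sum \<F> \<phi> T = g T"
    and "\<forall>T\<in>S. superset_sum \<F> \<phi> T = 0 \<Longrightarrow> F \<in> \<F> \<Longrightarrow> \<phi> F = 0"
proof -
  have ss: "superset_sum \<F> \<phi> T = (\<Sum>F\<in>\<F>. of_bool (T \<subseteq> F) * \<phi> F)" for T \<phi>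
    unfolding superset_sum_def using fin by (intro sum.mono_neutral_cong_left) auto
  obtain Y where Y:
    "\<And>F F'. F \<in> \<F> \<Longrightarrow> F' \<in> \<F> \<Longrightarrow> (\<Sum>T\<in>S. Y F T * of_bool (T \<subseteq> F')) = (of_bool (F = F') :: int)"
    "\<And>T T'. T \<in> S \<Longrightarrow> T' \<in> S \<Longrightarrow> (\<Sum>F\<in>\<F>. of_bool (T \<subseteq> F) * Y F T') = (of_bool (T = T') :: int)"
    by (rule inclusion_basis_inverse[OF assms]) blast
  show "\<exists>\<phi>. \<forall>T\<in>S. superset_sum \<F> \<phi> T = g T"
  proof (intro exI[of _ "\<lambda>F. \<Sum>T'\<in>S. Y F T' * g T'"] ballI)
    fix T assume T: "T \<in> S"
    have "superset_sum \<F> (\<lambda>F. \<Sum>T'\<in>S. Y F T' * g T') T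
        = (\<Sum>T'\<in>S. (\<Sum>F\<in>\<F>. of_bool (T \<subseteq> F) * Y F T') * g T')"
      unfolding ss sum_distrib_left sum_distrib_right by (subst sum.swap) (simp add: mult.assoc)
    also have "\<dots> = (\<Sum>T'\<in>S. of_bool (T = T') * g T')"
      by (intro sum.cong refl) (simp only: Y(2)[OF T])
    also have "\<dots> = g T" using T fin by simp
    finally show "superset_sum \<F> (\<lambda>F. \<Sum>T'\<in>S. Y F T' * g T') T = g T" .
  qed
  show "\<phi> F = 0" if z: "\<forall>T\<in>S. superset_sum \<F> \<phi> T = 0" and F: "F \<in> \<F>"
  proof -
    have "0 = (\<Sum>T\<in>S. Y F T * (\<Sum>F'\<in>\<F>. of_bool (T \<subseteq> F') * \<phi> F'))"
      using z by (simp only: ss) simp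
    also have "\<dots> = (\<Sum>F'\<in>\<F>. (\<Sum>T\<in>S. Y F T * of_bool (T \<subseteq> F')) * \<phi> F')"
      unfolding sum_distrib_left sum_distrib_right by (subst sum.swap) (simp add: mult.assoc)
    also have "\<dots> = (\<Sum>F'\<in>\<F>. of_bool (F = F') * \<phi> F')"
      by (intro sum.cong refl) (simp only: Y(1)[OF F])
    also have "\<dots> = \<phi> F" using F fin by simp
    finally show ?thesis by simp
  qed
qed


section \<open>Ballot sets\<close>

text \<open>If \<open>W\<close> is an initial segment of the positive integers, the \<open>i\<close>-th smallest element of a
  ballot set is at least \<open>2 i\<close>: in every initial segment of \<open>W\<close> at most half of the elements are
  chosen. These sets are the second rows of the standard Young tableaux with two rows.\<close>

definition ballot_sets :: "'a::linorder set \<Rightarrow> 'a set set" where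
  "ballot_sets W = {T. T \<subseteq> W \<and> (\<forall>x\<in>T. 2 * card (T \<inter> {..x}) \<le> card (W \<inter> {..x}))}"

lemma finite_ballot_sets: "finite W \<Longrightarrow> finite (ballot_sets W)"
  by (rule finite_subset[of _ "Pow W"]) (auto simp: ballot_sets_def)

lemma ballot_sets_card:
  assumes "finite W" "T \<in> ballot_sets W"
  shows "2 * card T \<le> card W"
proof (cases "T = {}")
  case False
  have T: "T \<subseteq> W" using assms by (simp add: ballot_sets_def)
  with assms have fin: "finite T" by (meson finite_subset)
  have "T \<inter> {..Max T} = T" using fin by auto
  moreover have "2 * card (T \<inter> {..Max T}) \<le> card (W \<inter> {..Max T})"
    using assms(2) Max_in[OF fin False] by (auto simp: ballot_sets_def)
  moreover have "card (W \<inter> {..Max T}) \<le> card W" using assms by (intro card_mono) auto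
  ultimately show ?thesis by simp
qed simp

lemma ballot_sets_card_0:
  assumes "finite W"
  shows "{T \<in> ballot_sets W. card T = 0} = {{}}"
proof (intro equalityI subsetI)
  fix T assume "T \<in> {T \<in> ballot_sets W. card T = 0}"
  then have "T \<subseteq> W" "card T = 0" by (simp_all add: ballot_sets_def)
  then show "T \<in> {{}}" using finite_subset[OF _ assms] by simp
qed (simp add: ballot_sets_def)

text \<open>A new largest element only imposes the condition at itself, which concerns the total number
  of chosen elements.\<close>

lemma ballot_sets_insert:
  assumes "finite A" and less: "\<And>a. a \<in> A \<Longrightarrow> a < m"
  shows "ballot_sets (insert m A)
    = ballot_sets A \<union> insert m ` {T \<in> ballot_sets A. 2 * Suc (card T) \<le> Suc (card A)}"
proof -
  have m: "m \<notin> A" using less by blast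
  have below: "insert m X \<inter> {..x} = X \<inter> {..x}" if "x \<in> A" for X x
    using less[OF that] by auto
  have top: "insert m X \<inter> {..m} = insert m X" if "X \<subseteq> A" for X
    using that less by (fastforce intro: less_imp_le)
  have without: "T \<in> ballot_sets (insert m A) \<longleftrightarrow> T \<in> ballot_sets A" if T: "T \<subseteq> A" for T
  proof -
    have "card (insert m A \<inter> {..x}) = card (A \<inter> {..x})" if "x \<in> T" for x
      using below that T by (metis subsetD)
    then show ?thesis using T unfolding ballot_sets_def by auto
  qed
  have "with": "insert m T \<in> ballot_sets (insert m A) \<longleftrightarrow>
      T \<in> ballot_sets A \<and> 2 * Suc (card T) \<le> Suc (card A)" if T: "T \<subseteq> A" for T
  proof -
    have fT: "finite T" "m \<notin> T" using that assms finite_subset m by blast+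
    have "2 * card (insert m T \<inter> {..m}) \<le> card (insert m A \<inter> {..m})
        \<longleftrightarrow> 2 * Suc (card T) \<le> Suc (card A)"
      unfolding top[OF T] top[OF order_refl] using fT m assms(1) by simp
    moreover have "2 * card (insert m T \<inter> {..x}) \<le> card (insert m A \<inter> {..x})
        \<longleftrightarrow> 2 * card (T \<inter> {..x}) \<le> card (A \<inter> {..x})" if "x \<in> T" for x
      using below that T by (metis subsetD)
    ultimately show ?thesis using T unfolding ballot_sets_def by blast
  qed
  have sub: "T \<subseteq> A" if "T \<in> ballot_sets A" for T
    using that by (simp add: ballot_sets_def)
  show ?thesis
  proof (intro equalityI subsetI)
    fix T assume T: "T \<in> ballot_sets (insert m A)"
    then have TA: "T \<subseteq> insert m A" by (simp add: ballot_sets_def)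
    show "T \<in> ballot_sets A
        \<union> insert m ` {T \<in> ballot_sets A. 2 * Suc (card T) \<le> Suc (card A)}"
    proof (cases "m \<in> T")
      case True
      then have "T = insert m (T - {m})" "T - {m} \<subseteq> A" using TA by auto
      then obtain T' where T': "T = insert m T'" "T' \<subseteq> A" by blast
      show ?thesis using T "with"[OF T'(2)] unfolding T'(1) by blast
    next
      case False
      then show ?thesis using T TA without[of T] by auto
    qed
  next
    fix T assume "T \<in> ballot_sets A
        \<union> insert m ` {T \<in> ballot_sets A. 2 * Suc (card T) \<le> Suc (card A)}"
    then show "T \<in> ballot_sets (insert m A)"
      using without "with" sub by blast
  qed
qed

lemma nsets_insert:
  assumes "m \<notin> A"
  shows "nsets (insert m A) (Suc j) = nsets A (Suc j) \<union> insert m ` nsets A j"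
proof (intro equalityI subsetI)
  fix N assume N: "N \<in> nsets (insert m A) (Suc j)"
  show "N \<in> nsets A (Suc j) \<union> insert m ` nsets A j"
  proof (cases "m \<in> N")
    case True
    then have "N = insert m (N - {m})" "N - {m} \<in> nsets A j"
      using N by (auto simp: nsets_def)
    then show ?thesis by blast
  qed (use N in \<open>auto simp: nsets_def\<close>)
qed (use assms in \<open>auto simp: nsets_def card_insert_if\<close>)

text \<open>Induction on \<open>W\<close>, removing its largest element \<open>m\<close>. If \<open>2 * j \<le> card W - 1\<close>, the
  bounds on the cardinalities are those of the induction hypotheses for the \<open>j\<close>-sets without \<open>m\<close>
  and the \<open>j\<close>-sets with \<open>m\<close>, so that \<open>inclusion_basis_cone\<close> applies. For larger \<open>j\<close> the ballot
  sets with \<open>m\<close> match the \<open>j\<close>-sets without \<open>m\<close>, and the ballot sets without \<open>m\<close> match the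
  \<open>j\<close>-sets with \<open>m\<close>, so that \<open>inclusion_basis_cone_swap\<close> applies.\<close>

theorem ballot_basis:
  assumes "finite W" "j \<le> card W"
  shows "inclusion_basis {T \<in> ballot_sets W. card T \<le> min j (card W - j)} (nsets W j)"
  using assms
proof (induction W arbitrary: j rule: finite_linorder_max_induct)
  case empty
  have "{T \<in> ballot_sets ({} :: 'a set). card T \<le> 0} = {{}}" by (auto simp: ballot_sets_def)
  then show ?case using empty inclusion_basis_point[of "{}"] by simp
next
  case (insert m A)
  let ?n = "card A"
  have m: "m \<notin> A" using insert.hyps by blast
  have fT: "finite T" "m \<notin> T" if "T \<in> ballot_sets A" for T
    using that insert.hyps m by (auto simp: ballot_sets_def intro: finite_subset)
  have card: "card (insert m A) = Suc ?n" using insert.hyps m by simp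
  have bs: "ballot_sets (insert m A)
    = ballot_sets A \<union> insert m ` {T \<in> ballot_sets A. 2 * Suc (card T) \<le> Suc ?n}"
    using insert.hyps by (intro ballot_sets_insert) auto
  have part: "{T \<in> ballot_sets (insert m A). card T \<le> d}
      = {T \<in> ballot_sets A. card T \<le> d}
        \<union> insert m ` {T \<in> ballot_sets A. Suc (card T) \<le> d \<and> 2 * Suc (card T) \<le> Suc ?n}" for d
  proof -
    have "card (insert m T) = Suc (card T)" if "T \<in> ballot_sets A" for T
      using fT[OF that] by simp
    then have "{T \<in> ballot_sets A. Suc (card T) \<le> d \<and> 2 * Suc (card T) \<le> Suc ?n}
        = {T \<in> {T \<in> ballot_sets A. 2 * Suc (card T) \<le> Suc ?n}. card (insert m T) \<le> d}"
      by auto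
    moreover have "{T \<in> P \<union> insert m ` Q. card T \<le> d}
        = {T \<in> P. card T \<le> d} \<union> insert m ` {T \<in> Q. card (insert m T) \<le> d}" for P Q
      by auto
    ultimately show ?thesis unfolding bs by simp
  qed
  have "j = 0 \<or> j = Suc ?n \<or> (\<exists>i. j = Suc i \<and> j \<le> ?n)"
    using insert.prems card by (cases j) auto
  then consider "j = 0" | "j = Suc ?n" | i where "j = Suc i" "j \<le> ?n" by blast
  then show ?case
  proof cases
    case 1
    then show ?thesis using insert.hyps ballot_sets_card_0[of "insert m A"] inclusion_basis_point[of "{}"] by simp
  next
    case 2
    have "nsets (insert m A) j = {insert m A}"
      using insert.hyps m card 2 by (auto simp: nsets_def dest: card_subset_eq[rotated])
    then show ?thesis using insert.hyps 2 card ballot_sets_card_0[of "insert m A"] inclusion_basis_point by simp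
  next
    case 3
    let ?B = "\<lambda>d. {T \<in> ballot_sets A. card T \<le> d}"
    have fin: "finite (?B d)" for d using finite_ballot_sets[OF insert.hyps(1)] by simp
    have ns: "nsets (insert m A) j = nsets A j \<union> insert m ` nsets A i"
      using nsets_insert[OF m] 3 by simp
    have avoid: "m \<notin> \<Union> (?B d)" "m \<notin> \<Union> (nsets A d)" for d
      using m by (auto simp: ballot_sets_def nsets_def)
    show ?thesis
    proof (cases "2 * j \<le> ?n")
      case True
      have "{T \<in> ballot_sets (insert m A). card T \<le> min j (card (insert m A) - j)}
        = ?B j \<union> insert m ` ?B i"
        unfolding part using True 3 card by auto
      moreover have "inclusion_basis (?B j \<union> insert m ` ?B i) (nsets A j \<union> insert m ` nsets A i)"
        using insert.IH[of j] insert.IH[of i] True 3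
        by (intro inclusion_basis_cone fin avoid) (auto simp: min_def split: if_splits)
      ultimately show ?thesis unfolding ns by simp
    next
      case False
      have "{T \<in> ballot_sets (insert m A). card T \<le> min j (card (insert m A) - j)}
        = ?B (Suc ?n - j) \<union> insert m ` ?B (?n - j)"
        unfolding part using False 3 card by auto
      moreover have "inclusion_basis (?B (Suc ?n - j) \<union> insert m ` ?B (?n - j))
          (nsets A j \<union> insert m ` nsets A i)"
      proof (intro inclusion_basis_cone_swap fin avoid)
        show "?B (?n - j) \<subseteq> ?B (Suc ?n - j)" by auto
        show "inclusion_basis (?B (?n - j)) (nsets A j)"
          using insert.IH[of j] False 3 by (simp add: min_def split: if_splits)
        have "?B (Suc ?n - j) = ?B (min i (?n - i))"
          using 3 False ballot_sets_card[OF insert.hyps(1)] by fastforce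
        then show "inclusion_basis (?B (Suc ?n - j)) (nsets A i)"
          using insert.IH[of i] 3 by simp
      qed
      ultimately show ?thesis unfolding ns by simp
    qed
  qed
qed


section \<open>Graded bases of shifted complexes\<close>

text \<open>For \<open>v = q = 0\<close> these are the ballot sets of size at most \<open>k\<close> in \<open>{1..n}\<close>. In general they are
  the sets beyond \<open>v\<close> that remain ballot sets after \<open>q\<close> further elements up to \<open>v\<close> have been put
  in front of them, that is, the deletions and links met when the smallest points are removed one after another.\<close>

definition shifted_complex :: "nat \<Rightarrow> nat \<Rightarrow> nat \<Rightarrow> nat \<Rightarrow> nat set set" where
  "shifted_complex n v q k =
     {T. T \<subseteq> {v<..n} \<and> card T \<le> k \<and> (\<forall>x\<in>T. 2 * (card (T \<inter> {..x}) + q) \<le> x)}"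

text \<open>When \<open>v\<close> is this large, the ballot condition holds automatically: at most
  \<open>min k (x - v)\<close> elements of a set beyond \<open>v\<close> are bounded by \<open>x\<close>.\<close>

lemma shifted_complex_full:
  assumes "v = k + 2 * q" "j \<le> k"
  shows "{F \<in> shifted_complex n v q k. card F = j} = nsets {v<..n} j"
proof -
  have "2 * (card (T \<inter> {..x}) + q) \<le> x" if T: "T \<subseteq> {v<..n}" "card T \<le> k" "x \<in> T" for T x
  proof -
    have "card (T \<inter> {..x}) \<le> card {v<..x}" using T(1) by (intro card_mono) auto
    moreover have "card (T \<inter> {..x}) \<le> card T"
      using finite_subset[OF T(1)] by (intro card_mono) auto
    moreover have "v < x" using T(1,3) by auto
    ultimately show ?thesis using assms T(2) by simp
  qed
  moreover have "finite T" if "T \<subseteq> {v<..n}" for T using that finite_subset by blast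
  ultimately show ?thesis using assms(2)
    unfolding shifted_complex_def nsets_def by (intro Collect_cong) auto
qed

lemma shifted_complex_nonvertex:
  assumes "v + 1 < 2 * (q + 1)"
  shows "shifted_complex n v q k = shifted_complex n (v + 1) q k"
proof -
  have "v + 1 \<notin> T" if "T \<in> shifted_complex n v q k" for T
  proof
    assume v: "v + 1 \<in> T"
    have T: "T \<subseteq> {v<..n}" "\<forall>x\<in>T. 2 * (card (T \<inter> {..x}) + q) \<le> x"
      using that by (simp_all add: shifted_complex_def)
    then have "finite (T \<inter> {..v + 1})" "T \<inter> {..v + 1} \<noteq> {}" using v by auto
    then have "card (T \<inter> {..v + 1}) > 0" by (simp add: card_gt_0_iff)
    moreover have "2 * (card (T \<inter> {..v + 1}) + q) \<le> v + 1" using T v by blast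
    ultimately show False using assms by simp
  qed
  moreover have "T \<subseteq> {v + 1<..n} \<longleftrightarrow> T \<subseteq> {v<..n} \<and> v + 1 \<notin> T" for T :: "nat set"
    by (auto simp: subset_iff) (metis Suc_lessI)
  ultimately show ?thesis unfolding shifted_complex_def by blast
qed

text \<open>The deletion and the link of the point \<open>v + 1\<close>. In the link this point becomes one of the
  elements in front, which raises \<open>q\<close>.\<close>

lemma shifted_complex_vertex:
  assumes v: "2 * (q + 1) \<le> v + 1" "v + 1 \<le> n"
  shows "shifted_complex n v q (Suc k) = shifted_complex n (v + 1) q (Suc k)
    \<union> insert (v + 1) ` shifted_complex n (v + 1) (q + 1) k"
proof -
  have link: "insert (v + 1) T \<in> shifted_complex n v q (Suc k) \<longleftrightarrow>
      T \<in> shifted_complex n (v + 1) (q + 1) k" if T: "T \<subseteq> {v + 1<..n}" for T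
  proof -
    have fT: "finite T" "v + 1 \<notin> T" using T finite_subset by auto
    have "insert (v + 1) T \<inter> {..v + 1} = {v + 1}" using T by auto
    then have "card (insert (v + 1) T \<inter> {..v + 1}) = card {v + 1}" by (rule arg_cong)
    then have "2 * (card (insert (v + 1) T \<inter> {..v + 1}) + q) \<le> v + 1"
      using v(1) by (simp del: Int_insert_left)
    moreover have "card (insert (v + 1) T \<inter> {..x}) = Suc (card (T \<inter> {..x}))" if "x \<in> T" for x
    proof -
      have "insert (v + 1) T \<inter> {..x} = insert (v + 1) (T \<inter> {..x})" using T that by auto
      then show ?thesis using fT by simp
    qed
    then have "(\<forall>x\<in>T. 2 * (card (insert (v + 1) T \<inter> {..x}) + q) \<le> x) \<longleftrightarrow>
        (\<forall>x\<in>T. 2 * (card (T \<inter> {..x}) + (q + 1)) \<le> x)" by simp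
    moreover have "insert (v + 1) T \<subseteq> {v<..n}" using T v by auto
    moreover have "card (insert (v + 1) T) = Suc (card T)" using fT by simp
    ultimately show ?thesis using T unfolding shifted_complex_def by simp
  qed
  have del: "T \<in> shifted_complex n v q (Suc k) \<longleftrightarrow> T \<in> shifted_complex n (v + 1) q (Suc k)"
    if "v + 1 \<notin> T" for T
  proof -
    have "T \<subseteq> {v + 1<..n} \<longleftrightarrow> T \<subseteq> {v<..n}"
      using that by (auto simp: subset_iff) (metis Suc_lessI)
    then show ?thesis by (simp add: shifted_complex_def)
  qed
  show ?thesis
  proof (intro equalityI subsetI)
    fix T assume T: "T \<in> shifted_complex n v q (Suc k)"
    show "T \<in> shifted_complex n (v + 1) q (Suc k)
        \<union> insert (v + 1) ` shifted_complex n (v + 1) (q + 1) k"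
    proof (cases "v + 1 \<in> T")
      case True
      have "T - {v + 1} \<subseteq> {v + 1<..n}"
        using T by (fastforce simp: shifted_complex_def subset_iff)
      moreover have "T = insert (v + 1) (T - {v + 1})" using True by blast
      ultimately obtain T' where "T = insert (v + 1) T'" "T' \<subseteq> {v + 1<..n}" by metis
      then show ?thesis using T link[of T'] by blast
    qed (use T del in blast)
  next
    fix T assume T: "T \<in> shifted_complex n (v + 1) q (Suc k)
        \<union> insert (v + 1) ` shifted_complex n (v + 1) (q + 1) k"
    have sub: "T \<subseteq> {v + 1<..n}" if "T \<in> shifted_complex n (v + 1) q k" for T q k
      using that by (simp add: shifted_complex_def)
    show "T \<in> shifted_complex n v q (Suc k)"
    proof (cases "T \<in> shifted_complex n (v + 1) q (Suc k)")
      case True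
      then have "v + 1 \<notin> T" using sub[OF True] by auto
      then show ?thesis using True del by simp
    next
      case False
      then obtain T' where "T = insert (v + 1) T'" "T' \<in> shifted_complex n (v + 1) (q + 1) k"
        using T by blast
      then show ?thesis using link sub by blast
    qed
  qed
qed

text \<open>One and the same family \<open>S\<close> has to serve for all levels of the complex. Then the chains of
  indicator functions, one for each \<open>T \<in> S\<close>, run through all the levels from \<open>card T\<close> to \<open>k\<close>.\<close>

definition graded_basis :: "nat \<Rightarrow> 'a set set \<Rightarrow> 'a set set \<Rightarrow> bool" where
  "graded_basis k S \<Delta> \<longleftrightarrow> (\<forall>T\<in>S. card T \<le> k) \<and>
     (\<forall>j\<le>k. inclusion_basis {T \<in> S. card T \<le> j} {F \<in> \<Delta>. card F = j})"

lemma graded_basis_cone: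
  assumes S0: "graded_basis (Suc k) S0 \<Delta>0" and S1: "graded_basis k S1 \<Delta>1"
    and fin: "finite S0" "finite S1" "\<And>T. T \<in> S1 \<union> \<Delta>1 \<Longrightarrow> finite T"
    and v: "v \<notin> \<Union>S0" "v \<notin> \<Union>S1" "v \<notin> \<Union>\<Delta>0" "v \<notin> \<Union>\<Delta>1"
  shows "graded_basis (Suc k) (S0 \<union> insert v ` S1) (\<Delta>0 \<union> insert v ` \<Delta>1)"
proof -
  have card: "card (insert v T) = Suc (card T)" if "T \<in> S1 \<union> \<Delta>1" for T
    using fin(3)[OF that] that v by (intro card_insert_disjoint) blast+
  have split: "{T \<in> P \<union> insert v ` Q. R (card T)}
      = {T \<in> P. R (card T)} \<union> insert v ` {T \<in> Q. R (Suc (card T))}"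
    if "Q \<subseteq> S1 \<union> \<Delta>1" for P Q R
  proof -
    have "{T \<in> Q. R (Suc (card T))} = {T \<in> Q. R (card (insert v T))}"
      using that card by (intro Collect_cong) auto
    moreover have "{T \<in> P \<union> insert v ` Q. R (card T)}
        = {T \<in> P. R (card T)} \<union> insert v ` {T \<in> Q. R (card (insert v T))}" by auto
    ultimately show ?thesis by (simp only:)
  qed
  have "inclusion_basis {T \<in> S0 \<union> insert v ` S1. card T \<le> j}
      {F \<in> \<Delta>0 \<union> insert v ` \<Delta>1. card F = j}" if j: "j \<le> Suc k" for j
    unfolding split[OF Un_upper1, of S0 "\<lambda>c. c \<le> j"] split[OF Un_upper2, of \<Delta>0 "\<lambda>c. c = j"]
  proof (rule inclusion_basis_cone)
    show "finite {T \<in> S0. card T \<le> j}" "finite {T \<in> S1. Suc (card T) \<le> j}"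
      using fin by simp_all
    show "v \<notin> \<Union> {T \<in> S0. card T \<le> j}" "v \<notin> \<Union> {T \<in> S1. Suc (card T) \<le> j}"
      "v \<notin> \<Union> {F \<in> \<Delta>0. card F = j}" "v \<notin> \<Union> {F \<in> \<Delta>1. Suc (card F) = j}"
      using v by blast+
    show "inclusion_basis {T \<in> S0. card T \<le> j} {F \<in> \<Delta>0. card F = j}"
      using S0 j unfolding graded_basis_def by blast
    show "inclusion_basis {T \<in> S1. Suc (card T) \<le> j} {F \<in> \<Delta>1. Suc (card F) = j}"
    proof (cases j)
      case 0
      then show ?thesis using inclusion_basis_empty by simp
    next
      case (Suc i)
      then have "i \<le> k" using j by simp
      then show ?thesis using S1 unfolding graded_basis_def Suc by simp
    qed
  qed
  moreover have "card T \<le> Suc k" if "T \<in> S0 \<union> insert v ` S1" for T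
    using that S0 S1 card unfolding graded_basis_def by auto
  ultimately show ?thesis unfolding graded_basis_def by blast
qed

lemma graded_basis_0:
  assumes "{F \<in> \<Delta>. card F = 0} = {{}}"
  shows "graded_basis 0 {{}} \<Delta>"
proof -
  have "{T \<in> {{}} :: 'a set set. card T \<le> 0} = {{}}" by auto
  then have "inclusion_basis {T \<in> {{}}. card T \<le> 0} {F \<in> \<Delta>. card F = 0}"
    using inclusion_basis_point[of "{}"] assms by (simp only:)
  then show ?thesis unfolding graded_basis_def by simp
qed

text \<open>At level \<open>j\<close>, \<open>ballot_basis\<close> bounds cardinalities by \<open>min j (card W - j)\<close> instead of
  \<open>j\<close>. The difference matters only if \<open>j = k\<close> and \<open>card W = 2 * k - 1\<close>, and then no ballot
  set in \<open>W\<close> has \<open>k\<close> elements.\<close>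

lemma graded_basis_full:
  fixes W :: "'a::linorder set"
  assumes W: "finite W" "2 * k \<le> card W + 1"
    and \<Delta>: "\<And>j. j \<le> k \<Longrightarrow> {F \<in> \<Delta>. card F = j} = nsets W j"
  shows "graded_basis k {T \<in> ballot_sets W. card T \<le> k} \<Delta>"
proof -
  have "inclusion_basis {T \<in> {T \<in> ballot_sets W. card T \<le> k}. card T \<le> j} {F \<in> \<Delta>. card F = j}"
    if j: "j \<le> k" for j
  proof -
    have "card T \<le> k \<and> card T \<le> j \<longleftrightarrow> card T \<le> min j (card W - j)"
      if "T \<in> ballot_sets W" for T
      using ballot_sets_card[OF W(1) that] W(2) j by linarith
    then have "{T \<in> {T \<in> ballot_sets W. card T \<le> k}. card T \<le> j}
        = {T \<in> ballot_sets W. card T \<le> min j (card W - j)}"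
      by blast
    moreover have "j \<le> card W" using W j by linarith
    ultimately show ?thesis
      using ballot_basis[OF W(1), of j] \<Delta>[OF j] by simp
  qed
  then show ?thesis unfolding graded_basis_def by simp
qed

text \<open>Points are removed from the lower end. Passing to the deletion of \<open>v + 1\<close> raises \<open>v\<close>,
  passing to its link raises \<open>v\<close> and \<open>q\<close> and lowers \<open>k\<close>; both lower the induction measure
  and preserve the two hypotheses. When \<open>v\<close> reaches \<open>k + 2 * q\<close>, the complex consists of all
  sets of size at most \<open>k\<close> in \<open>{v<..n}\<close>, and the first hypothesis says that this interval has at
  least \<open>2 * k - 1\<close> elements, as \<open>graded_basis_full\<close> requires.\<close>

theorem shifted_complex_basis:
  assumes "3 * k + 2 * q \<le> n + 1" "v \<le> k + 2 * q"
  shows "\<exists>S \<subseteq> Pow {v<..n}. graded_basis k S (shifted_complex n v q k)"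
  using assms
proof (induction "2 * k + 2 * q - v" arbitrary: k q v rule: less_induct)
  case less
  consider "k = 0" | "v = k + 2 * q" | i where "k = Suc i" "v < k + 2 * q"
    using less.prems(2) by (metis le_neq_implies_less not0_implies_Suc)
  then show ?case
  proof cases
    case 1
    have "{F \<in> shifted_complex n v q k. card F = 0} = {{}}"
    proof (intro equalityI subsetI)
      fix F assume "F \<in> {F \<in> shifted_complex n v q k. card F = 0}"
      then have "F \<subseteq> {v<..n}" "card F = 0" by (simp_all add: shifted_complex_def)
      then show "F \<in> {{}}" using finite_subset[of F "{v<..n}"] by simp
    qed (simp add: shifted_complex_def)
    then show ?thesis unfolding 1 using graded_basis_0 by blast
  next
    case 2
    have "graded_basis k {T \<in> ballot_sets {v<..n}. card T \<le> k} (shifted_complex n v q k)"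
      using less.prems 2 by (intro graded_basis_full shifted_complex_full) auto
    moreover have "{T \<in> ballot_sets {v<..n}. card T \<le> k} \<subseteq> Pow {v<..n}"
      by (auto simp: ballot_sets_def)
    ultimately show ?thesis by blast
  next
    case 3
    let ?m = "v + 1"
    have "\<exists>S \<subseteq> Pow {?m<..n}. graded_basis k S (shifted_complex n ?m q k)"
      using 3 less.prems by (intro less.hyps) auto
    then obtain S0 where S0: "S0 \<subseteq> Pow {?m<..n}" "graded_basis k S0 (shifted_complex n ?m q k)"
      by blast
    have mono: "Pow {?m<..n} \<subseteq> Pow {v<..n}" by auto
    show ?thesis
    proof (cases "?m < 2 * (q + 1)")
      case True
      show ?thesis
        unfolding shifted_complex_nonvertex[OF True] using S0 mono by blast
    next
      case False
      have "\<exists>S \<subseteq> Pow {?m<..n}. graded_basis i S (shifted_complex n ?m (q + 1) i)"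
        using 3 less.prems by (intro less.hyps) auto
      then obtain S1 where S1: "S1 \<subseteq> Pow {?m<..n}"
        "graded_basis i S1 (shifted_complex n ?m (q + 1) i)"
        by blast
      have sub: "shifted_complex n ?m q' k' \<subseteq> Pow {?m<..n}" for q' k'
        by (auto simp: shifted_complex_def)
      have avoid: "?m \<notin> \<Union>X" if "X \<subseteq> Pow {?m<..n}" for X
        using that by fastforce
      have fin: "finite X" if "X \<subseteq> Pow {?m<..n}" for X
        by (rule finite_subset[OF that]) simp
      have "shifted_complex n v q k = shifted_complex n ?m q k
          \<union> insert ?m ` shifted_complex n ?m (q + 1) i"
        unfolding 3(1) using False less.prems 3 by (intro shifted_complex_vertex) auto
      moreover have "graded_basis (Suc i) (S0 \<union> insert ?m ` S1)
          (shifted_complex n ?m q k \<union> insert ?m ` shifted_complex n ?m (q + 1) i)"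
      proof (rule graded_basis_cone[OF _ S1(2)])
        show "graded_basis (Suc i) S0 (shifted_complex n ?m q k)" using S0(2) 3(1) by simp
        show "finite T" if "T \<in> S1 \<union> shifted_complex n ?m (q + 1) i" for T
          using that S1(1) sub by (intro finite_subset[of T "{?m<..n}"]) blast+
      qed (intro fin avoid S0(1) S1(1) sub)+
      moreover have "S0 \<union> insert ?m ` S1 \<subseteq> Pow {v<..n}"
      proof -
        have "?m \<in> {v<..n}" using less.prems 3 by auto
        then show ?thesis using S0(1) S1(1) mono by blast
      qed
      ultimately show ?thesis unfolding 3(1) by (metis (no_types, lifting))
    qed
  qed
qed


section \<open>The Johnson scheme in superset sums\<close>

lemma zbinom_of_nat: "zbinom (int a) (int b) = int (a choose b)"
  by (auto simp: zbinom_def binomial_eq_0)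

lemma card_nsets: "finite A \<Longrightarrow> card (nsets A k) = card A choose k"
proof -
  assume A: "finite A"
  have "nsets A k = {B. B \<subseteq> A \<and> card B = k}"
    unfolding nsets_def using finite_subset[OF _ A] by blast
  then show ?thesis using n_subsets[OF A] by simp
qed

lemma sum_Pow_card:
  fixes h :: "nat \<Rightarrow> int"
  assumes "finite S"
  shows "(\<Sum>T\<in>Pow S. h (card T)) = (\<Sum>v = 0..card S. int (card S choose v) * h v)"
proof -
  have "(\<Sum>T\<in>Pow S. h (card T)) = (\<Sum>v\<in>{0..card S}. \<Sum>T\<in>{T \<in> Pow S. card T = v}. h (card T))"
    using assms by (intro sum.group[symmetric]) (auto intro: card_mono)
  also have "\<dots> = (\<Sum>v = 0..card S. int (card S choose v) * h v)"
    by (intro sum.cong refl) (simp add: Pow_def n_subsets[OF assms])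
  finally show ?thesis .
qed

text \<open>Such a \<open>K'\<close> consists of \<open>T\<close>, of \<open>l - card (T \<inter> K)\<close> elements of \<open>K - T\<close>, and of
  \<open>k - l - card (T - K)\<close> elements outside \<open>K \<union> T\<close>. If one of these numbers is negative, there is
  no such set and the corresponding binomial coefficient vanishes.\<close>

lemma card_prescribed_intersections:
  assumes V: "finite V" "K \<subseteq> V" "T \<subseteq> V"
  shows "int (card {K' \<in> nsets V k. T \<subseteq> K' \<and> card (K \<inter> K') = l})
    = zbinom (int (card K) - int (card (T \<inter> K))) (int l - int (card (T \<inter> K)))
      * zbinom (int (card V) - int (card K) - int (card T) + int (card (T \<inter> K)))
          (int k - int l - int (card T) + int (card (T \<inter> K)))"
proof -
  let ?v = "card (T \<inter> K)"
  let ?X = "{K' \<in> nsets V k. T \<subseteq> K' \<and> card (K \<inter> K') = l}"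
  have fin: "finite K" "finite T" using V finite_subset by blast+
  have T: "card T = ?v + card (T - K)"
    using fin by (metis card_Int_Diff)
  have K: "card K = ?v + card (K - T)"
    using card_Int_Diff[OF fin(1), of T] by (simp add: Int_commute)
  have rest: "card V + ?v = card K + card T + card (V - K - T)"
  proof -
    have "card (V - (K \<union> T)) + card (K \<union> T) = card V"
      using V card_mono[of V "K \<union> T"] fin by (simp add: card_Diff_subset)
    moreover have "card (K \<union> T) + ?v = card K + card T"
      using card_Un_Int[OF fin] by (simp add: Int_commute)
    moreover have "V - K - T = V - (K \<union> T)" by blast
    ultimately show ?thesis by simp
  qed
  have inter: "card (K \<inter> K') = ?v + card (K' \<inter> (K - T))" if "T \<subseteq> K'" for K'
  proof -
    have "K \<inter> K' = (T \<inter> K) \<union> (K' \<inter> (K - T))" using that by blast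
    moreover have "card ((T \<inter> K) \<union> (K' \<inter> (K - T))) = ?v + card (K' \<inter> (K - T))"
      using fin by (intro card_Un_disjoint) auto
    ultimately show ?thesis by simp
  qed
  have total: "card K' = card (K \<inter> K') + card (T - K) + card (K' - K - T)"
    if "T \<subseteq> K'" "finite K'" for K'
  proof -
    have "card K' = card (K' \<inter> K) + card (K' - K)" by (rule card_Int_Diff[OF that(2)])
    moreover have "card (K' - K) = card ((K' - K) \<inter> T) + card (K' - K - T)"
      using that(2) by (intro card_Int_Diff) simp
    moreover have "(K' - K) \<inter> T = T - K" using that(1) by blast
    ultimately show ?thesis by (simp add: Int_commute)
  qed
  show ?thesis
  proof (cases "?v \<le> l \<and> l + card (T - K) \<le> k")
    case False
    have "K' \<notin> ?X" for K'
    proof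
      assume "K' \<in> ?X"
      then have "finite K'" "card K' = k" "T \<subseteq> K'" "card (K \<inter> K') = l"
        by (simp_all add: nsets_def)
      then show False using False inter[of K'] total[of K'] by linarith
    qed
    then have "?X = {}" by blast
    then have "int (card ?X) = 0" by (simp only: card.empty of_nat_0)
    moreover have "int l - int ?v < 0 \<or> int k - int l - int (card T) + int ?v < 0"
      using False T by linarith
    then have "zbinom (int (card K) - int ?v) (int l - int ?v) = 0 \<or>
        zbinom (int (card V) - int (card K) - int (card T) + int ?v)
          (int k - int l - int (card T) + int ?v) = 0"
      unfolding zbinom_def by auto
    ultimately show ?thesis by (metis mult_zero_left mult_zero_right)
  next
    case True
    define a c where "a = l - ?v" and "c = k - l - card (T - K)"
    let ?f = "\<lambda>(X, Y). T \<union> X \<union> Y" and ?g = "\<lambda>K'. (K' \<inter> (K - T), K' - K - T)"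
    have "bij_betw ?f (nsets (K - T) a \<times> nsets (V - K - T) c) ?X"
    proof (rule bij_betw_byWitness[where f' = ?g])
      show "\<forall>p\<in>nsets (K - T) a \<times> nsets (V - K - T) c. ?g (?f p) = p"
        unfolding nsets_def by (clarsimp; blast)
      show "\<forall>K'\<in>?X. ?f (?g K') = K'"
        unfolding nsets_def by (clarsimp; blast)
      show "?f ` (nsets (K - T) a \<times> nsets (V - K - T) c) \<subseteq> ?X"
      proof (rule image_subsetI)
        fix p assume "p \<in> nsets (K - T) a \<times> nsets (V - K - T) c"
        then obtain X Y where p: "p = (X, Y)"
          and X: "X \<subseteq> K - T" "finite X" "card X = a"
          and Y: "Y \<subseteq> V - K - T" "finite Y" "card Y = c"
          unfolding nsets_def by blast
        let ?K = "T \<union> X \<union> Y"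
        have "?K \<inter> (K - T) = X" "?K - K - T = Y" using X Y by blast+
        moreover have "finite ?K" "T \<subseteq> ?K" using X Y fin by auto
        ultimately have "card (K \<inter> ?K) = l" "card ?K = k"
          using inter[of ?K] total[of ?K] X(3) Y(3) True by (simp_all add: a_def c_def)
        moreover have "?K \<subseteq> V" using X Y V by blast
        ultimately have "?K \<in> ?X" using \<open>finite ?K\<close> \<open>T \<subseteq> ?K\<close> by (simp add: nsets_def)
        then show "?f p \<in> ?X" using p by simp
      qed
      show "?g ` ?X \<subseteq> nsets (K - T) a \<times> nsets (V - K - T) c"
      proof (rule image_subsetI)
        fix K' assume "K' \<in> ?X"
        then have K': "K' \<subseteq> V" "finite K'" "card K' = k" "T \<subseteq> K'" "card (K \<inter> K') = l"
          by (simp_all add: nsets_def)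
        then have "card (K' \<inter> (K - T)) = a" "card (K' - K - T) = c"
          using inter[of K'] total[of K'] by (simp_all add: a_def c_def)
        moreover have "K' \<inter> (K - T) \<subseteq> K - T" "K' - K - T \<subseteq> V - K - T" using K' by blast+
        ultimately show "?g K' \<in> nsets (K - T) a \<times> nsets (V - K - T) c"
          using K'(2) by (simp add: nsets_def)
      qed
    qed
    then have "card ?X = (card (K - T) choose a) * (card (V - K - T) choose c)"
      using V fin by (simp add: bij_betw_same_card[symmetric] card_cartesian_product card_nsets)
    moreover have "int (card K) - int ?v = int (card (K - T))" "int l - int ?v = int a"
      "int (card V) - int (card K) - int (card T) + int ?v = int (card (V - K - T))"
      "int k - int l - int (card T) + int ?v = int c"
      using K rest T True by (simp_all add: a_def c_def)
    ultimately show ?thesis by (simp only: zbinom_of_nat of_nat_mult)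
  qed
qed

text \<open>Up to signs, \<open>johnson_f\<close> is the Moebius transform over subsets of the right-hand side,
  which is a function of \<open>card S\<close>; inverting it recovers the right-hand side.\<close>

lemma johnson_f_inversion:
  assumes "finite S"
  shows "(\<Sum>U\<in>Pow S. johnson_f (card U) j n k l)
    = zbinom (int k - int (card S)) (int l - int (card S))
      * zbinom (int n - int k - int j + int (card S)) (int k - int l - int j + int (card S))"
proof -
  define G where "G v = zbinom (int k - int v) (int l - int v)
      * zbinom (int n - int k - int j + int v) (int k - int l - int j + int v)" for v
  \<comment> \<open>With this sign the transform is an involution.\<close>
  have "(-1) ^ card S * johnson_f (card S) j n k l = (\<Sum>T\<in>Pow S. (-1) ^ card T * G (card T))"
    if "finite S" for S :: "'a set"
  proof -
    have "(-1) ^ card S * johnson_f (card S) j n k l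
        = (\<Sum>v = 0..card S. int (card S choose v) * ((-1) ^ v * G v))"
      unfolding johnson_f_def sum_distrib_left G_def
      by (intro sum.cong refl) (simp add: zbinom_of_nat power_add flip: mult.assoc power_mult_distrib)
    then show ?thesis by (simp only: sum_Pow_card[OF that, of "\<lambda>v. (-1) ^ v * G v"])
  qed
  from inclusion_exclusion_symmetric[where f = "\<lambda>S. G (card S)", OF this assms]
  have "G (card S) = (\<Sum>U\<in>Pow S. (-1) ^ card U * ((-1) ^ card U * johnson_f (card U) j n k l))"
    by simp
  also have "\<dots> = (\<Sum>U\<in>Pow S. johnson_f (card U) j n k l)"
    by (intro sum.cong refl) (simp flip: mult.assoc power_mult_distrib)
  finally show ?thesis by (simp add: G_def)
qed

text \<open>The count of \<open>card_prescribed_intersections\<close> depends on \<open>K\<close> only through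
  \<open>card (T \<inter> K)\<close>, so \<open>johnson_f_inversion\<close> spreads it over the subsets of \<open>T \<inter> K\<close>.\<close>

lemma sum_assoc_matrix:
  assumes K: "K \<in> nsets {1..n} k" and T: "T \<subseteq> {1..n}"
  shows "(\<Sum>K'\<in>{K' \<in> nsets {1..n} k. T \<subseteq> K'}. assoc_matrix l K K')
    = (\<Sum>U\<in>Pow (T \<inter> K). johnson_f (card U) (card T) n k l)"
proof -
  have KV: "K \<subseteq> {1..n}" "card K = k" "finite K" using K by (simp_all add: nsets_def)
  let ?A = "{K' \<in> nsets {1..n} k. T \<subseteq> K'}"
  have fin: "finite ?A" by (simp add: finite_imp_finite_nsets)
  have "(\<Sum>K'\<in>?A. assoc_matrix l K K') = (\<Sum>K'\<in>{K' \<in> ?A. card (K \<inter> K') = l}. 1)"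
    unfolding assoc_matrix_def by (rule sum.inter_filter[OF fin, symmetric])
  also have "\<dots> = int (card {K' \<in> nsets {1..n} k. T \<subseteq> K' \<and> card (K \<inter> K') = l})"
    by (simp add: conj_assoc)
  also have "\<dots> = (\<Sum>U\<in>Pow (T \<inter> K). johnson_f (card U) (card T) n k l)"
    using card_prescribed_intersections[OF _ KV(1) T, of k l] KV
    by (simp add: johnson_f_inversion del: Pow_Int_eq)
  finally show ?thesis .
qed

text \<open>After summing over \<open>K\<close>, a subset \<open>U\<close> of \<open>T\<close> occurs once for every \<open>K\<close> that contains
  it. Thus superset sums turn the matrix of the scheme into an operator that sees only
  inclusions and cardinalities, and that can be restricted to any family closed under subsets.\<close>

theorem superset_sum_johnson:
  fixes b :: "nat \<Rightarrow> int"
  assumes T: "T \<subseteq> {1..n}"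
  shows "superset_sum (nsets {1..n} k)
      (\<lambda>K'. \<Sum>K\<in>nsets {1..n} k. a K * (\<Sum>l = 0..k. b l * assoc_matrix l K K')) T
    = (\<Sum>U\<in>Pow T. (\<Sum>l = 0..k. b l * johnson_f (card U) (card T) n k l)
        * superset_sum (nsets {1..n} k) a U)"
proof -
  let ?N = "nsets {1..n} k"
  let ?c = "\<lambda>U. \<Sum>l = 0..k. b l * johnson_f (card U) (card T) n k l"
  have fin: "finite ?N" "finite (Pow T)"
    using T finite_subset by (auto simp: finite_imp_finite_nsets)
  have "superset_sum ?N (\<lambda>K'. \<Sum>K\<in>?N. a K * (\<Sum>l = 0..k. b l * assoc_matrix l K K')) T
      = (\<Sum>K\<in>?N. a K * (\<Sum>l = 0..k. b l * (\<Sum>K'\<in>{K' \<in> ?N. T \<subseteq> K'}. assoc_matrix l K K')))"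
    unfolding superset_sum_def sum_distrib_left
    by (subst sum.swap) (intro sum.cong refl sum.swap)
  also have "\<dots> = (\<Sum>K\<in>?N. a K * (\<Sum>U\<in>Pow (T \<inter> K). ?c U))"
  proof (intro sum.cong refl arg_cong2[where f = "(*)"])
    fix K assume "K \<in> ?N"
    then have "(\<Sum>l = 0..k. b l * (\<Sum>K'\<in>{K' \<in> ?N. T \<subseteq> K'}. assoc_matrix l K K'))
        = (\<Sum>l = 0..k. \<Sum>U\<in>Pow (T \<inter> K). b l * johnson_f (card U) (card T) n k l)"
      by (simp only: sum_assoc_matrix[OF _ T] sum_distrib_left)
    also have "\<dots> = (\<Sum>U\<in>Pow (T \<inter> K). ?c U)" by (rule sum.swap)
    finally show "(\<Sum>l = 0..k. b l * (\<Sum>K'\<in>{K' \<in> ?N. T \<subseteq> K'}. assoc_matrix l K K'))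
        = (\<Sum>U\<in>Pow (T \<inter> K). ?c U)" .
  qed
  also have "\<dots> = (\<Sum>K\<in>?N. \<Sum>U\<in>{U \<in> Pow T. U \<subseteq> K}. ?c U * a K)"
  proof (intro sum.cong refl)
    fix K
    have eq: "Pow (T \<inter> K) = {U \<in> Pow T. U \<subseteq> K}" by blast
    show "a K * (\<Sum>U\<in>Pow (T \<inter> K). ?c U) = (\<Sum>U\<in>{U \<in> Pow T. U \<subseteq> K}. ?c U * a K)"
      unfolding eq mult.commute[of "a K"] by (rule sum_distrib_right)
  qed
  also have "\<dots> = (\<Sum>U\<in>Pow T. \<Sum>K\<in>{K \<in> ?N. U \<subseteq> K}. ?c U * a K)"
    by (rule sum.swap_restrict[OF fin])
  finally show ?thesis by (simp only: superset_sum_def sum_distrib_left)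
qed


section \<open>The complex of ballot sets and its chains\<close>

lemma shifted_complex_ballot:
  "shifted_complex n 0 0 k = {T \<in> ballot_sets {1..n}. card T \<le> k}"
proof -
  have W: "{0<..n} = {1..n}" by auto
  have "card ({1..n} \<inter> {..x}) = x" if "T \<subseteq> {1..n}" "x \<in> T" for T x
  proof -
    have "x \<le> n" using that by auto
    then show ?thesis by (simp add: min_def)
  qed
  then have "(\<forall>x\<in>T. 2 * card (T \<inter> {..x}) \<le> card ({1..n} \<inter> {..x})) \<longleftrightarrow>
      (\<forall>x\<in>T. 2 * (card (T \<inter> {..x}) + 0) \<le> x)" if "T \<subseteq> {1..n}" for T
    using that by (metis add_0_right)
  then show ?thesis
    unfolding shifted_complex_def ballot_sets_def W by blast
qed

lemma shifted_complex_nsets_basis: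
  assumes "3 * k \<le> n + 1" "j \<le> k"
  shows "inclusion_basis {T \<in> shifted_complex n 0 0 k. card T \<le> j} (nsets {1..n} j)"
proof -
  have "{T \<in> shifted_complex n 0 0 k. card T \<le> j}
      = {T \<in> ballot_sets {1..n}. card T \<le> min j (card {1..n} - j)}"
    unfolding shifted_complex_ballot using assms by auto
  moreover have "j \<le> card {1..n}" using assms by simp
  ultimately show ?thesis using ballot_basis[of "{1..n}" j] by simp
qed

lemma finite_shifted_complex: "finite (shifted_complex n v q k)"
  by (rule finite_subset[of _ "Pow {v<..n}"]) (auto simp: shifted_complex_def)

lemma shifted_complex_down:
  assumes "F \<in> shifted_complex n v q k" "U \<subseteq> F"
  shows "U \<in> shifted_complex n v q k"
proof -
  have F: "F \<subseteq> {v<..n}" "card F \<le> k" "\<forall>x\<in>F. 2 * (card (F \<inter> {..x}) + q) \<le> x"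
    using assms(1) by (simp_all add: shifted_complex_def)
  have fin: "finite F" using F(1) finite_subset by blast
  have "card (U \<inter> {..x}) \<le> card (F \<inter> {..x})" for x
    using assms(2) fin by (intro card_mono) auto
  then have "2 * (card (U \<inter> {..x}) + q) \<le> x" if "x \<in> U" for x
    using F(3) assms(2) that by (meson add_le_mono1 mult_le_mono2 order_trans subsetD)
  moreover have "card U \<le> k" using card_mono[OF fin assms(2)] F(2) by simp
  moreover have "U \<subseteq> {v<..n}" using assms(2) F(1) by blast
  ultimately show ?thesis by (simp add: shifted_complex_def)
qed

lemma card_level_eq:
  assumes "finite A"
  shows "int (card {T \<in> A. card T = Suc s})
    = int (card {T \<in> A. card T \<le> Suc s}) - int (card {T \<in> A. card T \<le> s})"
proof -
  have "{T \<in> A. card T \<le> Suc s} = {T \<in> A. card T = Suc s} \<union> {T \<in> A. card T \<le> s}" by auto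
  then have "card {T \<in> A. card T \<le> Suc s} = card {T \<in> A. card T = Suc s} + card {T \<in> A. card T \<le> s}"
    using assms by (simp only:) (subst card_Un_disjoint, auto)
  then show ?thesis by simp
qed

text \<open>Invertible matrices are square. So \<open>S\<close> has as many members of size at most \<open>j\<close> as the
  complex has of size \<open>j\<close>, and the complex has as many members of size at most \<open>j\<close> as there are
  \<open>j\<close>-subsets of \<open>{1..n}\<close>. Taking differences twice gives the multiplicity.\<close>

lemma card_chain_starts:
  assumes n: "3 * k \<le> n + 1" and s: "s \<le> k"
    and S: "finite S" "graded_basis k S (shifted_complex n 0 0 k)"
  shows "int (card {T \<in> S. card T = s}) = johnson_mult n s"
proof -
  let ?D = "shifted_complex n 0 0 k"
  have D: "card {F \<in> ?D. card F \<le> j} = n choose j" if "j \<le> k" for j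
  proof -
    have "card {F \<in> ?D. card F \<le> j} = card (nsets {1..n} j)"
      using finite_shifted_complex
      by (intro inclusion_basis_card shifted_complex_nsets_basis n that)
        (auto simp: finite_imp_finite_nsets)
    then show ?thesis by (simp add: card_nsets)
  qed
  have S': "card {T \<in> S. card T \<le> j} = card {F \<in> ?D. card F = j}" if "j \<le> k" for j
    using S that finite_shifted_complex unfolding graded_basis_def
    by (intro inclusion_basis_card) auto
  have D0: "card {F \<in> ?D. card F = 0} = 1" using D[of 0] by simp
  have DS: "int (card {F \<in> ?D. card F = Suc j}) = int (n choose Suc j) - int (n choose j)"
    if "Suc j \<le> k" for j
    using card_level_eq[OF finite_shifted_complex, of n 0 0 k j] D[OF that] D[of j] that by simp
  consider "s = 0" | "s = 1" | t where "s = Suc (Suc t)"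
    by (metis One_nat_def not0_implies_Suc)
  then show ?thesis
  proof cases
    case 1
    then show ?thesis using S'[of 0] D0 by (simp add: johnson_mult_def zbinom_def)
  next
    case 2
    then show ?thesis using card_level_eq[OF S(1), of 0] S'[of 0] S'[of 1] D0 DS[of 0] s
      by (simp add: johnson_mult_def zbinom_def)
  next
    case (3 t)
    have "johnson_mult n s = int (n choose Suc (Suc t)) - 2 * int (n choose Suc t) + int (n choose t)"
    proof -
      have "int s - 1 = int (Suc t)" "int s - 2 = int t" using 3 by simp_all
      then show ?thesis unfolding johnson_mult_def by (simp only: zbinom_of_nat 3)
    qed
    then show ?thesis
      using card_level_eq[OF S(1), of "Suc t"] S'[of "Suc t"] S'[of s] DS[of t] DS[of "Suc t"] s 3
      by simp
  qed
qed

text \<open>On the left is the operator of \<open>superset_sum_johnson\<close>, applied to a combination of the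
  chains starting in \<open>S\<close>: \<open>a i T\<close> is the coefficient at level \<open>i\<close> of the chain of \<open>T\<close>. Each pair
  \<open>T \<subseteq> F\<close> has \<open>card F - card T choose i - card T\<close> intermediate sets of size \<open>i\<close>,
  so the operator acts on the coefficients of each chain separately.\<close>

lemma sum_chain_transfer:
  fixes c :: "nat \<Rightarrow> int" and a :: "nat \<Rightarrow> 'a set \<Rightarrow> int"
  assumes S: "finite S" and F: "finite F" "card F \<le> k"
  shows "(\<Sum>U\<in>Pow F. c (card U) * subset_sum S (a (card U)) U)
    = subset_sum S (\<lambda>T. \<Sum>i = card T..k. a i T *
        (zbinom (int (card F) - int (card T)) (int i - int (card T)) * c i)) F"
proof -
  have "(\<Sum>U\<in>Pow F. c (card U) * subset_sum S (a (card U)) U)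
      = (\<Sum>U\<in>Pow F. \<Sum>T\<in>{T \<in> {T \<in> S. T \<subseteq> F}. T \<subseteq> U}. c (card U) * a (card U) T)"
  proof (intro sum.cong refl)
    fix U assume "U \<in> Pow F"
    then have "{T \<in> S. T \<subseteq> U} = {T \<in> {T \<in> S. T \<subseteq> F}. T \<subseteq> U}" by blast
    then show "c (card U) * subset_sum S (a (card U)) U
        = (\<Sum>T\<in>{T \<in> {T \<in> S. T \<subseteq> F}. T \<subseteq> U}. c (card U) * a (card U) T)"
      by (simp only: subset_sum_def sum_distrib_left)
  qed
  also have "\<dots> = (\<Sum>T\<in>{T \<in> S. T \<subseteq> F}. \<Sum>U\<in>{U \<in> Pow F. T \<subseteq> U}. c (card U) * a (card U) T)"
    using S F by (intro sum.swap_restrict) auto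
  also have "\<dots> = (\<Sum>T\<in>{T \<in> S. T \<subseteq> F}. \<Sum>i = card T..k. a i T *
      (zbinom (int (card F) - int (card T)) (int i - int (card T)) * c i))"
  proof (intro sum.cong refl)
    fix T assume "T \<in> {T \<in> S. T \<subseteq> F}"
    then have T: "T \<subseteq> F" "finite T" using F finite_subset by auto
    let ?h = "\<lambda>i. c i * a i T"
    let ?d = "card F - card T"
    have d: "card (F - T) = ?d" by (rule card_Diff_subset[OF T(2,1)])
    have le: "card T \<le> card F" by (rule card_mono[OF F(1) T(1)])
    have "bij_betw (\<lambda>W. T \<union> W) (Pow (F - T)) {U \<in> Pow F. T \<subseteq> U}"
      using T by (intro bij_betw_byWitness[where f' = "\<lambda>U. U - T"]) auto
    then have "(\<Sum>U\<in>{U \<in> Pow F. T \<subseteq> U}. ?h (card U)) = (\<Sum>W\<in>Pow (F - T). ?h (card (T \<union> W)))"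
      by (rule sum.reindex_bij_betw[symmetric])
    also have "\<dots> = (\<Sum>W\<in>Pow (F - T). ?h (card T + card W))"
    proof (intro sum.cong refl)
      fix W assume "W \<in> Pow (F - T)"
      then have "card (T \<union> W) = card T + card W"
        using T F finite_subset[of W F] by (intro card_Un_disjoint) auto
      then show "?h (card (T \<union> W)) = ?h (card T + card W)" by simp
    qed
    also have "\<dots> = (\<Sum>v = 0..?d. int (?d choose v) * ?h (card T + v))"
      using sum_Pow_card[of "F - T" "\<lambda>v. ?h (card T + v)"] F d by simp
    also have "\<dots> = (\<Sum>i = card T..card F. int (?d choose (i - card T)) * ?h i)"
      using le by (intro sum.reindex_bij_witness[of _ "\<lambda>i. i - card T" "\<lambda>v. card T + v"]) auto
    also have "\<dots> = (\<Sum>i = card T..k. int (?d choose (i - card T)) * ?h i)"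
      using F(2) le by (intro sum.mono_neutral_left) (auto intro!: binomial_eq_0)
    also have "\<dots> = (\<Sum>i = card T..k. a i T *
      (zbinom (int (card F) - int (card T)) (int i - int (card T)) * c i))"
    proof (intro sum.cong refl)
      fix i assume "i \<in> {card T..k}"
      then have "int (card F) - int (card T) = int ?d" "int i - int (card T) = int (i - card T)"
        using le by auto
      then show "int (?d choose (i - card T)) * ?h i = a i T *
          (zbinom (int (card F) - int (card T)) (int i - int (card T)) * c i)"
        by (simp only: zbinom_of_nat) simp
    qed
    finally show "(\<Sum>U\<in>{U \<in> Pow F. T \<subseteq> U}. c (card U) * a (card U) T) = (\<Sum>i = card T..k. a i T *
      (zbinom (int (card F) - int (card T)) (int i - int (card T)) * c i))" .
  qed
  finally show ?thesis by (simp only: subset_sum_def)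
qed


section \<open>Block decompositions of Smith groups\<close>

lemma carrier_group_power:
  "group G \<Longrightarrow> carrier (group_power G m) = (\<Pi>\<^sub>E t\<in>{..<m}. carrier G)"
  unfolding group_power_def by (simp add: carrier_sum_group)

lemma group_group_power: "group G \<Longrightarrow> group (group_power G m)"
  unfolding group_power_def by simp

text \<open>The function \<open>coord\<close> is an additive change of coordinates, for each \<open>s\<close> into \<open>m s\<close> blocks
  indexed by \<open>D s\<close>. The assumption \<open>lattice\<close> says that the row lattice of \<open>M\<close> is the
  preimage of the product of the row lattices of the blocks, hence it is the kernel of the map into the product of
  the quotients.\<close>

theorem smith_group_block_decomposition:
  fixes coord :: "('c \<Rightarrow> int) \<Rightarrow> 's \<Rightarrow> nat \<Rightarrow> 'd \<Rightarrow> int"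
    and M :: "'r \<Rightarrow> 'c \<Rightarrow> int" and N :: "'s \<Rightarrow> 'e \<Rightarrow> 'd \<Rightarrow> int"
  assumes I: "finite I"
    and add: "\<And>x y s t j. x \<in> extensional C \<Longrightarrow> y \<in> extensional C \<Longrightarrow> s \<in> I \<Longrightarrow> t < m s \<Longrightarrow> j \<in> D s \<Longrightarrow>
      coord (\<lambda>c\<in>C. x c + y c) s t j = coord x s t j + coord y s t j"
    and surj: "\<And>\<beta>. \<exists>x\<in>extensional C. \<forall>s\<in>I. \<forall>t<m s. \<forall>j\<in>D s. coord x s t j = \<beta> s t j"
    and lattice: "\<And>x. x \<in> extensional C \<Longrightarrow> x \<in> row_lattice R C M \<longleftrightarrow>
      (\<forall>s\<in>I. \<forall>t<m s. restrict (coord x s t) (D s) \<in> row_lattice (E s) (D s) (N s))"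
  shows "smith_group R C M \<cong>
    sum_group I (\<lambda>s. group_power (smith_group (E s) (D s) (N s)) (m s))"
proof -
  let ?G = "product_group C (\<lambda>_. integer_group)"
  let ?P = "\<lambda>s. product_group (D s) (\<lambda>_. integer_group)"
  let ?L = "\<lambda>s. row_lattice (E s) (D s) (N s)"
  let ?S = "\<lambda>s. smith_group (E s) (D s) (N s)"
  let ?H = "sum_group I (\<lambda>s. group_power (?S s) (m s))"
  define q where "q s x = ?L s #>\<^bsub>?P s\<^esub> x" for s x
  define h where "h x = (\<lambda>s\<in>I. \<lambda>t\<in>{..<m s}. q s (restrict (coord x s t) (D s)))" for x
  have G: "group ?G" and P: "group (?P s)" for s by simp_all
  have carG: "carrier ?G = extensional C" by (auto simp: PiE_def)
  have carP: "carrier (?P s) = extensional (D s)" for s by (auto simp: PiE_def)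
  have N: "?L s \<lhd> ?P s" for s by (rule row_lattice_normal)
  have S: "group (?S s)" for s by (rule group_smith_group)
  have carS: "carrier (?S s) = q s ` extensional (D s)" for s
    unfolding smith_group_def FactGroup_def RCOSETS_def q_def carP[symmetric] by auto
  have q_hom: "q s x \<otimes>\<^bsub>?S s\<^esub> q s y = q s (x \<otimes>\<^bsub>?P s\<^esub> y)"
    if "x \<in> extensional (D s)" "y \<in> extensional (D s)" for s x y
    using normal.rcos_sum[OF N, of x s y] that
    unfolding smith_group_def q_def FactGroup_def carP by simp
  have q_one: "q s x = \<one>\<^bsub>?S s\<^esub> \<longleftrightarrow> x \<in> ?L s" if "x \<in> extensional (D s)" for s x
    using group.coset_join1[OF P] group.coset_join2[OF P] that carP normal_imp_subgroup[OF N]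
    unfolding smith_group_def q_def FactGroup_def
    by (metis (no_types, lifting) monoid.select_convs(2) subgroup.subset)
  have carH: "carrier ?H = (\<Pi>\<^sub>E s\<in>I. \<Pi>\<^sub>E t\<in>{..<m s}. carrier (?S s))"
    using I by (simp add: carrier_sum_group carrier_group_power group_group_power S)
  have H: "group ?H" by (simp add: group_group_power S)
  have hom: "h \<in> hom ?G ?H"
  proof (rule homI)
    fix x assume "x \<in> carrier ?G"
    show "h x \<in> carrier ?H" unfolding carH h_def carS by simp
  next
    fix x y assume xy: "x \<in> carrier ?G" "y \<in> carrier ?G"
    have "q s (restrict (coord (x \<otimes>\<^bsub>?G\<^esub> y) s t) (D s))
        = q s (restrict (coord x s t) (D s)) \<otimes>\<^bsub>?S s\<^esub> q s (restrict (coord y s t) (D s))"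
      if st: "s \<in> I" "t < m s" for s t
    proof -
      have "restrict (coord (x \<otimes>\<^bsub>?G\<^esub> y) s t) (D s)
          = restrict (coord x s t) (D s) \<otimes>\<^bsub>?P s\<^esub> restrict (coord y s t) (D s)"
        using add[of x y s t] xy st by (auto simp: carG simp del: carrier_product_group)
      then show ?thesis by (simp only: q_hom restrict_extensional)
    qed
    then show "h (x \<otimes>\<^bsub>?G\<^esub> y) = h x \<otimes>\<^bsub>?H\<^esub> h y"
      unfolding h_def group_power_def mult_sum_group
      by (intro restrict_ext) (simp add: restrict_def)
  qed
  interpret h: group_hom ?G ?H h
    using G H hom by (simp add: group_hom_def group_hom_axioms_def)
  have "h ` carrier ?G = carrier ?H"
  proof (intro equalityI subsetI)
    fix z assume "z \<in> h ` carrier ?G"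
    then show "z \<in> carrier ?H" using h.hom_closed by blast
  next
    fix z assume z: "z \<in> carrier ?H"
    have "\<forall>s\<in>I. \<forall>t\<in>{..<m s}. \<exists>w\<in>extensional (D s). z s t = q s w"
      using z unfolding carH carS PiE_iff image_iff by blast
    then obtain w where w: "\<And>s t. s \<in> I \<Longrightarrow> t < m s \<Longrightarrow> w s t \<in> extensional (D s) \<and> z s t = q s (w s t)"
      by (metis lessThan_iff)
    obtain x where x: "x \<in> extensional C"
      "\<And>s t j. s \<in> I \<Longrightarrow> t < m s \<Longrightarrow> j \<in> D s \<Longrightarrow> coord x s t j = w s t j"
      using surj[of w] by blast
    have "restrict (coord x s t) (D s) = w s t" if st: "s \<in> I" "t < m s" for s t
      using x(2)[OF st] w[OF st] by (intro extensionalityI[of _ "D s"]) auto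
    then have "h x = z"
      using w z unfolding h_def carH
      by (intro ext) (auto simp: PiE_def extensional_def restrict_def Pi_def)
    then show "z \<in> h ` carrier ?G" using x(1) carG by blast
  qed
  then have "?G Mod kernel ?G ?H h \<cong> ?H" by (rule h.FactGroup_iso)
  moreover have "kernel ?G ?H h = row_lattice R C M"
  proof -
    have "h x = \<one>\<^bsub>?H\<^esub> \<longleftrightarrow> x \<in> row_lattice R C M" if x: "x \<in> extensional C" for x
    proof -
      have "h x = \<one>\<^bsub>?H\<^esub> \<longleftrightarrow> (\<forall>s\<in>I. \<forall>t<m s. q s (restrict (coord x s t) (D s)) = \<one>\<^bsub>?S s\<^esub>)"
        unfolding h_def group_power_def one_sum_group
        by (simp add: fun_eq_iff restrict_def) (metis lessThan_iff)
      then show ?thesis using lattice[OF x] q_one by simp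
    qed
    moreover have "row_lattice R C M \<subseteq> extensional C" by (auto simp: row_lattice_def)
    ultimately show ?thesis unfolding kernel_def carG by blast
  qed
  ultimately show ?thesis by (simp only: smith_group_def)
qed


section \<open>The Smith group of the Johnson scheme\<close>

text \<open>With the change of coordinates that reads off the coefficients of \<open>\<Psi> x\<close> with respect to the
  chains, it remains to match the two lattices. A row combination \<open>a B\<close> is carried by \<open>\<Psi>\<close> to the
  operator applied to \<open>\<Psi> a\<close>, that is, to coefficients multiplied by the matrices \<open>johnson_M\<close>.
  Conversely, given rows of coefficients for the chains, surjectivity of \<open>\<Psi>\<close> provides the
  function \<open>\<psi>\<close> they come from, and injectivity of \<open>\<Psi>\<close> identifies \<open>\<psi> B\<close> with the given vector.\<close>

theorem theorem5p1:
  fixes n k :: nat and b :: "nat \<Rightarrow> int" and B :: "nat set \<Rightarrow> nat set \<Rightarrow> int"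
  assumes "int n \<ge> 3 * int k - 1" and "n \<ge> k"
    and "B = (\<lambda>X Y. \<Sum>l = 0..k. b l * assoc_matrix l X Y)"
  shows "smith_group (nsets {1..n} k) (nsets {1..n} k) B \<cong>
    sum_group {0..k}
      (\<lambda>s. group_power (smith_group {s..k} {s..k} (johnson_M n k b s)) (nat (johnson_mult n s)))"
proof -
  let ?N = "nsets {1..n} k"
  let ?D = "shifted_complex n 0 0 k"
  let ?m = "\<lambda>s. nat (johnson_mult n s)"
  let ?M = "johnson_M n k b"
  have n: "3 * k \<le> n + 1" using assms(1) by linarith
  obtain S where S: "S \<subseteq> Pow {0<..n}" "graded_basis k S ?D"
    using shifted_complex_basis[of k 0 n 0] n by auto
  have finS: "finite S" by (rule finite_subset[OF S(1)]) simp
  have finD: "finite F" "F \<subseteq> {1..n}" "card F \<le> k" if "F \<in> ?D" for F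
    using that finite_subset[of F "{0<..n}"] by (auto simp: shifted_complex_def subset_iff)
  have finN: "finite ?N" by (simp add: finite_imp_finite_nsets)
  have Scard: "card T \<le> k" if "T \<in> S" for T
    using S(2) that by (simp add: graded_basis_def)
  have level: "inclusion_basis {T \<in> S. card T \<le> j} {F \<in> ?D. card F = j}" if "j \<le> k" for j
    using S(2) that by (simp add: graded_basis_def)

  \<comment> \<open>Superset sums identify functions on the \<open>k\<close>-subsets with functions on the complex.\<close>
  have "{T \<in> ?D. card T \<le> k} = ?D" using finD(3) by blast
  then have top: "inclusion_basis ?D ?N"
    using shifted_complex_nsets_basis[OF n order_refl] by simp
  have onto: "\<exists>\<phi>. \<forall>T\<in>?D. superset_sum ?N \<phi> T = g T" for g
    by (rule inclusion_basis_dual(1)[OF finite_shifted_complex finN top])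
  have zero: "\<phi> K = 0" if "\<forall>T\<in>?D. superset_sum ?N \<phi> T = 0" "K \<in> ?N" for \<phi> K
    using inclusion_basis_dual(2)[OF finite_shifted_complex finN top, of \<phi> K] that by blast

  \<comment> \<open>For a function \<open>g\<close> on the complex, \<open>co g j T\<close> is the coefficient of the chain of \<open>T\<close> in the
    restriction of \<open>g\<close> to level \<open>j\<close>; it is determined for \<open>T \<in> S\<close> with \<open>card T \<le> j \<le> k\<close>.\<close>
  define co where "co g j = (SOME a. \<forall>F\<in>{F \<in> ?D. card F = j}. subset_sum {T \<in> S. card T \<le> j} a F = g F)"
    for g :: "nat set \<Rightarrow> int" and j
  have co: "subset_sum S (co g (card F)) F = g F" if F: "F \<in> ?D" for g F
  proof -
    have "\<exists>a. \<forall>F'\<in>{F' \<in> ?D. card F' = card F}. subset_sum {T \<in> S. card T \<le> card F} a F' = g F'"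
      using level[OF finD(3)[OF F]] unfolding inclusion_basis_def by blast
    then have "\<forall>F'\<in>{F' \<in> ?D. card F' = card F}.
        subset_sum {T \<in> S. card T \<le> card F} (co g (card F)) F' = g F'"
      unfolding co_def by (rule someI_ex)
    then have "subset_sum {T \<in> S. card T \<le> card F} (co g (card F)) F = g F" using F by blast
    then show ?thesis by (simp only: subset_sum_level[OF finD(1)[OF F]])
  qed
  have co_unique: "co g j T = a T"
    if "T \<in> S" "card T \<le> j" "j \<le> k" and a: "\<And>F. F \<in> ?D \<Longrightarrow> card F = j \<Longrightarrow> subset_sum S a F = g F"
    for g j T a
  proof (rule inclusion_basis_inj[OF level[OF that(3)]])
    fix F assume "F \<in> {F \<in> ?D. card F = j}"
    then have F: "F \<in> ?D" "card F = j" by auto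
    then show "subset_sum {T \<in> S. card T \<le> j} (co g j) F = subset_sum {T \<in> S. card T \<le> j} a F"
      using subset_sum_level[OF finD(1)[OF F(1)]] co[OF F(1), of g] a[OF F] by simp
  qed (use that in simp)

  \<comment> \<open>The copies of the block \<open>s\<close> are labelled by numbers, so the chains are enumerated.\<close>
  have "\<exists>e. bij_betw e {..<?m s} {T \<in> S. card T = s}" if "s \<le> k" for s
  proof -
    have "card {T \<in> S. card T = s} = ?m s"
      using card_chain_starts[OF n that finS S(2)] by linarith
    then show ?thesis
      using ex_bij_betw_nat_finite[of "{T \<in> S. card T = s}"] finS by (simp add: lessThan_atLeast0)
  qed
  then obtain e where e: "\<And>s. s \<le> k \<Longrightarrow> bij_betw (e s) {..<?m s} {T \<in> S. card T = s}"
    by metis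
  define idx where "idx T = inv_into {..<?m (card T)} (e (card T)) T" for T
  have eS: "e s t \<in> S" "card (e s t) = s" "idx (e s t) = t" if "s \<le> k" "t < ?m s" for s t
  proof -
    have "e s t \<in> {T \<in> S. card T = s}"
      using bij_betwE[OF e[OF that(1)]] that(2) by simp
    then show "e s t \<in> S" "card (e s t) = s" by simp_all
    then show "idx (e s t) = t"
      unfolding idx_def using bij_betw_inv_into_left[OF e[OF that(1)]] that(2) by simp
  qed
  have idx: "idx T < ?m (card T)" "e (card T) (idx T) = T" if "T \<in> S" for T
  proof -
    have im: "T \<in> e (card T) ` {..<?m (card T)}"
      using bij_betw_imp_surj_on[OF e[OF Scard[OF that]]] that by simp
    show "idx T < ?m (card T)" "e (card T) (idx T) = T"
      using inv_into_into[OF im] f_inv_into_f[OF im] by (simp_all add: idx_def)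
  qed

  define coord where "coord x s t j = co (superset_sum ?N x) j (e s t)" for x s t j
  \<comment> \<open>On chain coefficients the matrix of the scheme acts through the blocks.\<close>
  have rows: "superset_sum ?N (\<lambda>K'. \<Sum>K\<in>?N. a K * B K K') F
      = subset_sum S (\<lambda>T. \<Sum>i = card T..k. \<alpha> i T * ?M (card T) i (card F)) F"
    if F: "F \<in> ?D" and \<alpha>: "\<And>U. U \<in> ?D \<Longrightarrow> superset_sum ?N a U = subset_sum S (\<alpha> (card U)) U"
    for a F \<alpha>
  proof -
    let ?c = "\<lambda>i. \<Sum>l = 0..k. b l * johnson_f i (card F) n k l"
    have "superset_sum ?N (\<lambda>K'. \<Sum>K\<in>?N. a K * B K K') F
        = (\<Sum>U\<in>Pow F. ?c (card U) * superset_sum ?N a U)"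
      unfolding assms(3) by (rule superset_sum_johnson[OF finD(2)[OF F]])
    also have "\<dots> = (\<Sum>U\<in>Pow F. ?c (card U) * subset_sum S (\<alpha> (card U)) U)"
      using shifted_complex_down[OF F] \<alpha> by (intro sum.cong refl) simp
    also have "\<dots> = subset_sum S (\<lambda>T. \<Sum>i = card T..k. \<alpha> i T * ?M (card T) i (card F)) F"
      unfolding johnson_M_def by (rule sum_chain_transfer[OF finS finD(1,3)[OF F]])
    finally show ?thesis .
  qed
  show ?thesis
  proof (rule smith_group_block_decomposition[where coord = coord])
    show "finite {0..k}" by simp
  next
    fix x y :: "nat set \<Rightarrow> int" and s t j
    assume s: "s \<in> {0..k}" "t < ?m s" "j \<in> {s..k}"
    show "coord (\<lambda>K\<in>?N. x K + y K) s t j = coord x s t j + coord y s t j"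
      unfolding coord_def
    proof (rule co_unique[where a = "\<lambda>T. co (superset_sum ?N x) j T + co (superset_sum ?N y) j T"])
      fix F assume F: "F \<in> ?D" "card F = j"
      have "superset_sum ?N (\<lambda>K\<in>?N. x K + y K) F = superset_sum ?N (\<lambda>K. x K + y K) F"
        by (rule superset_sum_cong) simp
      also have "\<dots> = superset_sum ?N x F + superset_sum ?N y F"
        unfolding superset_sum_def by (rule sum.distrib)
      finally show "subset_sum S (\<lambda>T. co (superset_sum ?N x) j T + co (superset_sum ?N y) j T) F
          = superset_sum ?N (\<lambda>K\<in>?N. x K + y K) F"
        using co[OF F(1)] F(2) by (simp add: subset_sum_add)
    qed (use s eS in auto)
  next
    fix \<beta> :: "nat \<Rightarrow> nat \<Rightarrow> nat \<Rightarrow> int"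
    define a where "a j T = \<beta> (card T) (idx T) j" for j T
    obtain \<phi> where \<phi>: "\<And>F. F \<in> ?D \<Longrightarrow> superset_sum ?N \<phi> F = subset_sum S (a (card F)) F"
      using onto[of "\<lambda>F. subset_sum S (a (card F)) F"] by blast
    let ?x = "restrict \<phi> ?N"
    have x: "superset_sum ?N ?x F = superset_sum ?N \<phi> F" for F
      by (rule superset_sum_cong) simp
    have "coord ?x s t j = \<beta> s t j" if s: "s \<in> {0..k}" "t < ?m s" "j \<in> {s..k}" for s t j
    proof -
      have "coord ?x s t j = a j (e s t)"
        unfolding coord_def using s eS \<phi> x by (intro co_unique) auto
      then show ?thesis using s eS by (simp add: a_def)
    qed
    moreover have "?x \<in> extensional ?N" by simp
    ultimately show "\<exists>x\<in>extensional ?N. \<forall>s\<in>{0..k}. \<forall>t<?m s. \<forall>j\<in>{s..k}. coord x s t j = \<beta> s t j"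
      by blast
  next
    fix x :: "nat set \<Rightarrow> int" assume ext: "x \<in> extensional ?N"
    show "x \<in> row_lattice ?N ?N B \<longleftrightarrow> (\<forall>s\<in>{0..k}. \<forall>t<?m s.
        restrict (coord x s t) {s..k} \<in> row_lattice {s..k} {s..k} (?M s))"
    proof
      assume "x \<in> row_lattice ?N ?N B"
      then obtain a where a: "x = (\<lambda>K'\<in>?N. \<Sum>K\<in>?N. a K * B K K')"
        unfolding row_lattice_def by blast
      define \<alpha> where "\<alpha> = co (superset_sum ?N a)"
      have x: "superset_sum ?N x F
          = subset_sum S (\<lambda>T. \<Sum>i = card T..k. \<alpha> i T * ?M (card T) i (card F)) F" if "F \<in> ?D" for F
      proof -
        have "superset_sum ?N x F = superset_sum ?N (\<lambda>K'. \<Sum>K\<in>?N. a K * B K K') F"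
          by (rule superset_sum_cong) (simp add: a)
        then show ?thesis using rows[OF that, of a \<alpha>] co by (simp add: \<alpha>_def)
      qed
      have "coord x s t j = (\<Sum>i = s..k. \<alpha> i (e s t) * ?M s i j)"
        if s: "s \<in> {0..k}" "t < ?m s" "j \<in> {s..k}" for s t j
      proof -
        have "coord x s t j
            = (\<Sum>i = card (e s t)..k. \<alpha> i (e s t) * ?M (card (e s t)) i j)"
          unfolding coord_def
          by (rule co_unique[where a = "\<lambda>T. \<Sum>i = card T..k. \<alpha> i T * ?M (card T) i j"])
            (use s eS x in auto)
        then show ?thesis using s eS by simp
      qed
      then have "restrict (coord x s t) {s..k} = (\<lambda>j\<in>{s..k}. \<Sum>i\<in>{s..k}. \<alpha> i (e s t) * ?M s i j)"
        if "s \<in> {0..k}" "t < ?m s" for s t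
        using that by (intro restrict_ext) simp
      then show "\<forall>s\<in>{0..k}. \<forall>t<?m s.
          restrict (coord x s t) {s..k} \<in> row_lattice {s..k} {s..k} (?M s)"
        unfolding row_lattice_def mem_Collect_eq
        by (intro ballI allI impI) (rule exI[where x = "\<lambda>i. \<alpha> i (e _ _)"], simp)
    next
      assume lat: "\<forall>s\<in>{0..k}. \<forall>t<?m s.
        restrict (coord x s t) {s..k} \<in> row_lattice {s..k} {s..k} (?M s)"
      have "\<exists>A. \<forall>j\<in>{s..k}. coord x s t j = (\<Sum>i = s..k. A i * ?M s i j)"
        if "s \<le> k" "t < ?m s" for s t
      proof -
        have "restrict (coord x s t) {s..k} \<in> row_lattice {s..k} {s..k} (?M s)"
          using lat that by simp
        then obtain A where "restrict (coord x s t) {s..k} = (\<lambda>j\<in>{s..k}. \<Sum>i = s..k. A i * ?M s i j)"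
          unfolding row_lattice_def by blast
        then have "coord x s t j = (\<Sum>i = s..k. A i * ?M s i j)" if "j \<in> {s..k}" for j
          using that by (metis (no_types, lifting) restrict_apply')
        then show ?thesis by blast
      qed
      then obtain A where A: "\<And>s t j. s \<le> k \<Longrightarrow> t < ?m s \<Longrightarrow> j \<in> {s..k} \<Longrightarrow>
          coord x s t j = (\<Sum>i = s..k. A s t i * ?M s i j)"
        by metis
      define \<alpha> where "\<alpha> i T = A (card T) (idx T) i" for i T
      obtain \<psi> where \<psi>: "\<And>U. U \<in> ?D \<Longrightarrow> superset_sum ?N \<psi> U = subset_sum S (\<alpha> (card U)) U"
        using onto[of "\<lambda>U. subset_sum S (\<alpha> (card U)) U"] by blast
      let ?y = "\<lambda>K'. \<Sum>K\<in>?N. \<psi> K * B K K'"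
      have "superset_sum ?N (\<lambda>K. x K - ?y K) F = 0" if F: "F \<in> ?D" for F
      proof -
        have "superset_sum ?N ?y F
            = subset_sum S (\<lambda>T. \<Sum>i = card T..k. \<alpha> i T * ?M (card T) i (card F)) F"
          using rows[OF F \<psi>] .
        also have "\<dots> = subset_sum {T \<in> S. card T \<le> card F}
            (\<lambda>T. \<Sum>i = card T..k. \<alpha> i T * ?M (card T) i (card F)) F"
          by (simp only: subset_sum_level[OF finD(1)[OF F]])
        also have "\<dots> = subset_sum {T \<in> S. card T \<le> card F} (co (superset_sum ?N x) (card F)) F"
        proof (rule subset_sum_cong)
          fix T assume "T \<in> {T \<in> S. card T \<le> card F}"
          then have T: "T \<in> S" "card T \<le> card F" by simp_all
          have "coord x (card T) (idx T) (card F)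
              = (\<Sum>i = card T..k. A (card T) (idx T) i * ?M (card T) i (card F))"
            using A[OF Scard[OF T(1)] idx(1)[OF T(1)]] T(2) finD(3)[OF F] by simp
          then show "(\<Sum>i = card T..k. \<alpha> i T * ?M (card T) i (card F))
              = co (superset_sum ?N x) (card F) T"
            by (simp add: coord_def \<alpha>_def idx(2)[OF T(1)])
        qed
        also have "\<dots> = superset_sum ?N x F"
          by (simp only: subset_sum_level[OF finD(1)[OF F]] co[OF F])
        finally show ?thesis
          unfolding superset_sum_def by (simp add: sum_subtractf)
      qed
      then have "x K - ?y K = 0" if "K \<in> ?N" for K
        using zero[of "\<lambda>K. x K - ?y K"] that by blast
      then have "x = (\<lambda>K'\<in>?N. \<Sum>K\<in>?N. \<psi> K * B K K')"
        using ext by (intro extensionalityI[of _ ?N]) auto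
      then show "x \<in> row_lattice ?N ?N B" unfolding row_lattice_def by blast
    qed
  qed
qed

end
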